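(* Let $G=(V,E)$ be a graph with $|V|=N$ and $|E|=M$, with start node $s$, end node $t\neq s$, at least one $s$-$t$ path, and nominal edge costs $\hat c_e\ge0$, $e\in E$. The variable-sized robust shortest path problem on $G$ with constant growth, i.e. with $B=\prod_{e\in E}[-1,1]$, can be solved in time $O(NM+N^2\log(N))$, and the resulting set satisfies $|\mathcal{S}|\le N$.
   Context: Let $\mathcal{P}$ be the set of all paths from $s$ to $t$ and, for $P\in\mathcal{P}$ and costs $c\in\mathbb{R}^E$, let $c(P)=\sum_{e\in P}c_e$. For $\lambda\ge0$ let $\mathcal{U}_\lambda=\{\hat c\}+\lambda B$ and consider $\mathsf{P}(\lambda)$: $\min_{P\in\mathcal{P}}\max_{c\in\mathcal{U}_\lambda}c(P)$. Solving the variable-sized robust shortest path problem means computing a set $\mathcal{S}\subset\mathcal{P}$ of smallest possible size such that for every $\lambda\ge0$, $\mathcal{S}$ contains an optimal solution of $\mathsf{P}(\lambda)$. *)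

theory Defs
  imports Complex_Main "HOL-Library.FuncSet" "Graph_Theory.Arc_Walk"
begin

section \<open>Paths in directed and undirected graphs\<close>

text \<open>
  The text says ``graph'' without fixing an orientation, so both readings are covered.  In either
  case an edge \<open>e\<close> has the ends \<open>tail G e\<close> and \<open>head G e\<close>; for \<open>Undirected\<close> it may be traversed both
  ways, but it stays a single edge carrying a single cost.  Parallel edges and loops are allowed.
  A path from \<open>s\<close> to \<open>t\<close> repeats no vertex and is represented by its list of edges.
\<close>

datatype graph_kind = Directed | Undirected

definition bidirect :: "('v, 'e) pre_digraph \<Rightarrow> ('v, 'e \<times> bool) pre_digraph" where
  "bidirect G =
     \<lparr> verts = verts G,
       arcs = arcs G \<times> UNIV,
       tail = (\<lambda>(e, fwd). if fwd then tail G e else head G e),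
       head = (\<lambda>(e, fwd). if fwd then head G e else tail G e) \<rparr>"

fun st_paths :: "graph_kind \<Rightarrow> ('v, 'e) pre_digraph \<Rightarrow> 'v \<Rightarrow> 'v \<Rightarrow> 'e list set" where
  "st_paths Directed G s t = {p. pre_digraph.apath G s p t}"
| "st_paths Undirected G s t = map fst ` {p. pre_digraph.apath (bidirect G) s p t}"

definition path_cost :: "('e \<Rightarrow> real) \<Rightarrow> 'e list \<Rightarrow> real" where
  "path_cost c p = (\<Sum>e\<in>set p. c e)"


section \<open>The variable-sized robust shortest path problem\<close>

definition uncertainty_set :: "('e \<Rightarrow> real) \<Rightarrow> real \<Rightarrow> ('e \<Rightarrow> real) set \<Rightarrow> ('e \<Rightarrow> real) set" where
  "uncertainty_set c_hat lam B = {\<lambda>e. c_hat e + lam * b e | b. b \<in> B}"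

definition unit_box :: "'e set \<Rightarrow> ('e \<Rightarrow> real) set" where
  "unit_box E = (\<Pi>\<^sub>E e\<in>E. {-1..1})"

definition worst_cost :: "('e \<Rightarrow> real) set \<Rightarrow> 'e list \<Rightarrow> real" where
  "worst_cost U p = (GREATEST x. \<exists>c\<in>U. x = path_cost c p)"

definition robust_optimal ::
  "'e list set \<Rightarrow> ('e \<Rightarrow> real) \<Rightarrow> ('e \<Rightarrow> real) set \<Rightarrow> real \<Rightarrow> 'e list \<Rightarrow> bool" where
  "robust_optimal Ps c_hat B lam p \<longleftrightarrow>
     is_arg_min (worst_cost (uncertainty_set c_hat lam B)) (\<lambda>q. q \<in> Ps) p"

definition covers_all_sizes ::
  "'e list set \<Rightarrow> ('e \<Rightarrow> real) \<Rightarrow> ('e \<Rightarrow> real) set \<Rightarrow> 'e list set \<Rightarrow> bool" where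
  "covers_all_sizes Ps c_hat B S \<longleftrightarrow>
     finite S \<and> S \<subseteq> Ps \<and> (\<forall>lam\<ge>0. \<exists>p\<in>S. robust_optimal Ps c_hat B lam p)"

definition variable_sized_solution ::
  "'e list set \<Rightarrow> ('e \<Rightarrow> real) \<Rightarrow> ('e \<Rightarrow> real) set \<Rightarrow> 'e list set \<Rightarrow> bool" where
  "variable_sized_solution Ps c_hat B S \<longleftrightarrow> is_arg_min card (covers_all_sizes Ps c_hat B) S"


section \<open>Machine model\<close>

text \<open>
  Running times refer to the usual unit-cost real RAM, presented as while-programs.  A state has
  scalar variables and arrays, over natural numbers (indices, counters) and over exact reals.
  A program mentions only finitely many variable and array names, while array indices are computed
  at run time.  Every constant, memory access, arithmetic operation and comparison costs one step.
  Natural numbers can only be added and subtracted, and reals cannot be converted to natural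
  numbers, so that no work can be hidden by packing data into large numbers or by rounding.
\<close>

type_synonym name = string

record ram_state =
  nvar :: "name \<Rightarrow> nat"
  narr :: "name \<Rightarrow> nat \<Rightarrow> nat"
  rvar :: "name \<Rightarrow> real"
  rarr :: "name \<Rightarrow> nat \<Rightarrow> real"

datatype nexp =
    NConst nat
  | NVar name
  | NArr name nexp
  | NAdd nexp nexp
  | NSub nexp nexp

datatype rexp =
    RConst int
  | RVar name
  | RArr name nexp
  | RAdd rexp rexp
  | RSub rexp rexp
  | RMul rexp rexp
  | RDiv rexp rexp

datatype bexp =
    NLess nexp nexp
  | RLess rexp rexp
  | Neg bexp
  | Conj bexp bexp

datatype com =
    Skip
  | NAssign name nexp
  | NStore name nexp nexp
  | RAssign name rexp
  | RStore name nexp rexp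
  | Seq com com
  | If bexp com com
  | While bexp com

fun nval :: "nexp \<Rightarrow> ram_state \<Rightarrow> nat" where
  "nval (NConst k) \<sigma> = k"
| "nval (NVar x) \<sigma> = nvar \<sigma> x"
| "nval (NArr a i) \<sigma> = narr \<sigma> a (nval i \<sigma>)"
| "nval (NAdd u v) \<sigma> = nval u \<sigma> + nval v \<sigma>"
| "nval (NSub u v) \<sigma> = nval u \<sigma> - nval v \<sigma>"

fun ncost :: "nexp \<Rightarrow> nat" where
  "ncost (NConst k) = 1"
| "ncost (NVar x) = 1"
| "ncost (NArr a i) = 1 + ncost i"
| "ncost (NAdd u v) = 1 + ncost u + ncost v"
| "ncost (NSub u v) = 1 + ncost u + ncost v"

fun rval :: "rexp \<Rightarrow> ram_state \<Rightarrow> real" where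
  "rval (RConst k) \<sigma> = of_int k"
| "rval (RVar x) \<sigma> = rvar \<sigma> x"
| "rval (RArr a i) \<sigma> = rarr \<sigma> a (nval i \<sigma>)"
| "rval (RAdd u v) \<sigma> = rval u \<sigma> + rval v \<sigma>"
| "rval (RSub u v) \<sigma> = rval u \<sigma> - rval v \<sigma>"
| "rval (RMul u v) \<sigma> = rval u \<sigma> * rval v \<sigma>"
| "rval (RDiv u v) \<sigma> = rval u \<sigma> / rval v \<sigma>"

fun rcost :: "rexp \<Rightarrow> nat" where
  "rcost (RConst k) = 1"
| "rcost (RVar x) = 1"
| "rcost (RArr a i) = 1 + ncost i"
| "rcost (RAdd u v) = 1 + rcost u + rcost v"
| "rcost (RSub u v) = 1 + rcost u + rcost v"
| "rcost (RMul u v) = 1 + rcost u + rcost v"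
| "rcost (RDiv u v) = 1 + rcost u + rcost v"

fun bval :: "bexp \<Rightarrow> ram_state \<Rightarrow> bool" where
  "bval (NLess u v) \<sigma> \<longleftrightarrow> nval u \<sigma> < nval v \<sigma>"
| "bval (RLess u v) \<sigma> \<longleftrightarrow> rval u \<sigma> < rval v \<sigma>"
| "bval (Neg b) \<sigma> \<longleftrightarrow> \<not> bval b \<sigma>"
| "bval (Conj b c) \<sigma> \<longleftrightarrow> bval b \<sigma> \<and> bval c \<sigma>"

fun bcost :: "bexp \<Rightarrow> nat" where
  "bcost (NLess u v) = 1 + ncost u + ncost v"
| "bcost (RLess u v) = 1 + rcost u + rcost v"
| "bcost (Neg b) = 1 + bcost b"
| "bcost (Conj b c) = 1 + bcost b + bcost c"

text \<open>\<open>exec p \<sigma> T \<tau>\<close>: started in \<open>\<sigma>\<close>, the program \<open>p\<close> halts in \<open>\<tau>\<close> after exactly \<open>T\<close> steps.\<close>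

inductive exec :: "com \<Rightarrow> ram_state \<Rightarrow> nat \<Rightarrow> ram_state \<Rightarrow> bool" where
  Skip: "exec Skip \<sigma> 1 \<sigma>"
| NAssign: "exec (NAssign x u) \<sigma> (1 + ncost u) (\<sigma>\<lparr>nvar := (nvar \<sigma>)(x := nval u \<sigma>)\<rparr>)"
| NStore: "exec (NStore a i u) \<sigma> (1 + ncost i + ncost u)
    (\<sigma>\<lparr>narr := (narr \<sigma>)(a := (narr \<sigma> a)(nval i \<sigma> := nval u \<sigma>))\<rparr>)"
| RAssign: "exec (RAssign x r) \<sigma> (1 + rcost r) (\<sigma>\<lparr>rvar := (rvar \<sigma>)(x := rval r \<sigma>)\<rparr>)"
| RStore: "exec (RStore a i r) \<sigma> (1 + ncost i + rcost r)
    (\<sigma>\<lparr>rarr := (rarr \<sigma>)(a := (rarr \<sigma> a)(nval i \<sigma> := rval r \<sigma>))\<rparr>)"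
| Seq: "exec p \<sigma> m \<rho> \<Longrightarrow> exec q \<rho> n \<tau> \<Longrightarrow> exec (Seq p q) \<sigma> (m + n) \<tau>"
| IfTrue: "bval b \<sigma> \<Longrightarrow> exec p \<sigma> n \<tau> \<Longrightarrow> exec (If b p q) \<sigma> (1 + bcost b + n) \<tau>"
| IfFalse: "\<not> bval b \<sigma> \<Longrightarrow> exec q \<sigma> n \<tau> \<Longrightarrow> exec (If b p q) \<sigma> (1 + bcost b + n) \<tau>"
| WhileFalse: "\<not> bval b \<sigma> \<Longrightarrow> exec (While b p) \<sigma> (1 + bcost b) \<sigma>"
| WhileTrue: "bval b \<sigma> \<Longrightarrow> exec p \<sigma> m \<rho> \<Longrightarrow> exec (While b p) \<rho> n \<tau> \<Longrightarrow>
    exec (While b p) \<sigma> (1 + bcost b + m + n) \<tau>"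


section \<open>Instances, input and output\<close>

text \<open>
  As usual for algorithmic input, the vertices are numbered \<open>0, \<dots>, N - 1\<close> and the edges
  \<open>0, \<dots>, M - 1\<close>.  The graph is given as an edge list in arbitrary order.
\<close>

definition sp_instance ::
  "graph_kind \<Rightarrow> nat \<Rightarrow> nat \<Rightarrow> (nat, nat) pre_digraph \<Rightarrow> nat \<Rightarrow> nat \<Rightarrow> (nat \<Rightarrow> real) \<Rightarrow> bool" where
  "sp_instance kind N M G s t c_hat \<longleftrightarrow>
     fin_digraph G \<and> verts G = {..<N} \<and> arcs G = {..<M} \<and>
     s \<in> verts G \<and> t \<in> verts G \<and> t \<noteq> s \<and>
     st_paths kind G s t \<noteq> {} \<and>
     (\<forall>e\<in>arcs G. 0 \<le> c_hat e)"

definition input_state ::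
  "nat \<Rightarrow> nat \<Rightarrow> (nat, nat) pre_digraph \<Rightarrow> nat \<Rightarrow> nat \<Rightarrow> (nat \<Rightarrow> real) \<Rightarrow> ram_state" where
  "input_state N M G s t c_hat =
     \<lparr> nvar = (\<lambda>_. 0)(''N'' := N, ''M'' := M, ''s'' := s, ''t'' := t),
       narr = (\<lambda>_ _. 0)(''tail'' := (\<lambda>e. if e < M then tail G e else 0),
                        ''head'' := (\<lambda>e. if e < M then head G e else 0)),
       rvar = (\<lambda>_. 0),
       rarr = (\<lambda>_ _. 0)(''cost'' := (\<lambda>e. if e < M then c_hat e else 0)) \<rparr>"

text \<open>
  The output is the list of the paths in \<open>S\<close>, concatenated in the array \<open>''path''\<close>; the \<open>i\<close>-th path
  occupies the positions from \<open>''start''[i]\<close> up to, but excluding, \<open>''start''[i + 1]\<close>.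
\<close>

definition output_list :: "ram_state \<Rightarrow> nat list list" where
  "output_list \<tau> =
     map (\<lambda>i. map (narr \<tau> ''path'') [narr \<tau> ''start'' i ..< narr \<tau> ''start'' (Suc i)])
       [0 ..< nvar \<tau> ''size'']"

definition outputs_set :: "ram_state \<Rightarrow> nat list set \<Rightarrow> bool" where
  "outputs_set \<tau> S \<longleftrightarrow> distinct (output_list \<tau>) \<and> set (output_list \<tau>) = S"

end

theory Submission
  imports Defs
begin

text \<open>
  The worst case of a path \<open>P\<close> over the box of size \<open>lam\<close> is \<open>c(P) + lam * |P|\<close>, so every path is a
  line in \<open>lam\<close> whose slope is its number of edges.  The Bellman--Ford recursion computes, for every
  \<open>k < N\<close>, the minimum cost \<open>D k\<close> of a walk from \<open>s\<close> to \<open>t\<close> with exactly \<open>k\<close> edges.  Let \<open>k\<close> be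
  selected if, for some \<open>lam \<ge> 0\<close>, it is the least minimiser of \<open>D k + lam * k\<close>.  An optimal walk with
  \<open>k\<close> edges is then a path: removing a cycle would not increase the cost but give a minimiser with
  fewer edges.  The paths of the selected \<open>k\<close> thus solve the problem for every \<open>lam\<close>, and no smaller set
  does, because after a slight increase of \<open>lam\<close> every optimal path has exactly \<open>k\<close> edges.  The table
  takes \<open>O(N * (N + M))\<close> steps; testing each \<open>k\<close> against all others and writing its path takes
  \<open>O(N\<^sup>2)\<close> altogether.
\<close>

section \<open>Lower envelopes and optimal paths\<close>

lemma path_cost_mono:
  assumes "\<And>e. e \<in> set p \<Longrightarrow> c e \<le> d e"
  shows "path_cost c p \<le> path_cost d p"
  unfolding path_cost_def using assms by (rule sum_mono)

text \<open>As \<open>lam\<close> is nonnegative, the maximum is attained at the corner of the box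
  with all coordinates \<open>1\<close>. The slope is \<open>card (set p)\<close> because
  \<open>path_cost\<close> sums over a set; for paths this is the length, by
  \<open>pathsE\<close>.\<close>

lemma worst_cost_unit_box:
  assumes "set p \<subseteq> E" and "0 \<le> lam"
  shows "worst_cost (uncertainty_set c lam (unit_box E)) p = path_cost c p + lam * card (set p)"
  unfolding worst_cost_def
proof (rule Greatest_equality)
  \<comment> \<open>\<open>unit_box\<close> is an extensional product, so the corner has to be
    restricted to \<open>E\<close>; its values elsewhere do not matter, as \<open>p\<close> stays
    inside \<open>E\<close>.\<close>
  let ?b = "restrict (\<lambda>_. 1) E :: _ \<Rightarrow> real"
  have "?b \<in> unit_box E"
    by (auto simp: unit_box_def)
  then have "(\<lambda>e. c e + lam * ?b e) \<in> uncertainty_set c lam (unit_box E)"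
    unfolding uncertainty_set_def by blast
  moreover have "path_cost (\<lambda>e. c e + lam * ?b e) p = path_cost c p + lam * card (set p)"
  proof -
    have "path_cost (\<lambda>e. c e + lam * ?b e) p = (\<Sum>e\<in>set p. c e + lam)"
      unfolding path_cost_def using assms(1) by (intro sum.cong) auto
    then show ?thesis
      by (simp add: path_cost_def sum.distrib mult.commute)
  qed
  ultimately show "\<exists>d\<in>uncertainty_set c lam (unit_box E).
      path_cost c p + lam * card (set p) = path_cost d p"
    by metis
next
  fix x
  assume "\<exists>d\<in>uncertainty_set c lam (unit_box E). x = path_cost d p"
  then obtain b where b: "b \<in> unit_box E" and x: "x = path_cost (\<lambda>e. c e + lam * b e) p"
    by (auto simp: uncertainty_set_def)
  have "lam * b e \<le> lam * 1" if "e \<in> set p" for e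
    using b that assms by (intro mult_left_mono) (auto simp: unit_box_def PiE_def Pi_def)
  then have "x \<le> path_cost (\<lambda>e. c e + lam) p"
    unfolding x by (intro path_cost_mono) auto
  also have "\<dots> = path_cost c p + lam * card (set p)"
    by (simp add: path_cost_def sum.distrib mult.commute)
  finally show "x \<le> path_cost c p + lam * card (set p)" .
qed

section \<open>Lower envelopes of finitely many lines\<close>

text \<open>Ties go to the smaller index. This makes the minimiser unique for each
  \<open>lam\<close>, and the strict inequality later forces an optimal walk to be a path.\<close>

definition first_min :: "nat set \<Rightarrow> (nat \<Rightarrow> real) \<Rightarrow> real \<Rightarrow> nat \<Rightarrow> bool" where
  "first_min J D lam k \<longleftrightarrow> k \<in> J \<and>
     (\<forall>j\<in>J. (j < k \<longrightarrow> D k + lam * k < D j + lam * j) \<and> (k < j \<longrightarrow> D k + lam * k \<le> D j + lam * j))"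

text \<open>For finite \<open>J\<close> these are the lines that contribute a segment of positive
  length to the lower envelope over \<open>lam \<ge> 0\<close>; a line that only touches the
  envelope in a point loses a tie there to a smaller index.\<close>

definition envelope :: "nat set \<Rightarrow> (nat \<Rightarrow> real) \<Rightarrow> nat set" where
  "envelope J D = {k. \<exists>lam\<ge>0. first_min J D lam k}"

lemma first_min_le:
  assumes "first_min J D lam k" and "j \<in> J"
  shows "D k + lam * k \<le> D j + lam * j"
  using assms unfolding first_min_def by (cases j k rule: linorder_cases) force+

lemma first_min_exists:
  assumes "finite J" and "J \<noteq> {}"
  obtains k where "first_min J D lam k"
proof -
  define f where "f j = D j + lam * real j" for j
  define K where "K = {k\<in>J. \<forall>j\<in>J. f k \<le> f j}"
  have "arg_min_on f J \<in> K"
    unfolding K_def using arg_min_if_finite[OF assms, of f] by (auto simp: not_less)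
  moreover have "finite K"
    using assms(1) by (simp add: K_def)
  ultimately have "Min K \<in> K" and least: "\<And>j. j \<in> K \<Longrightarrow> Min K \<le> j"
    by (auto intro: Min_in Min_le)
  have "f (Min K) < f j" if "j \<in> J" "j < Min K" for j
  proof (rule ccontr)
    assume "\<not> f (Min K) < f j"
    then have "j \<in> K"
      using \<open>Min K \<in> K\<close> that(1) by (fastforce simp: K_def)
    then show False
      using least that(2) by fastforce
  qed
  then have "first_min J D lam (Min K)"
    using \<open>Min K \<in> K\<close> by (auto simp: first_min_def K_def f_def)
  then show ?thesis
    by (rule that)
qed

text \<open>Increasing \<open>lam\<close> slightly turns the ties with larger \<open>j\<close> into strict inequalities.\<close>

lemma envelope_strict_min:
  assumes "finite J" and "k \<in> envelope J D"
  obtains lam :: real where "0 < lam" "\<And>j. j \<in> J \<Longrightarrow> j \<noteq> k \<Longrightarrow> D k + lam * k < D j + lam * j"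
proof -
  obtain l where l: "0 \<le> l" "first_min J D l k"
    using assms(2) by (auto simp: envelope_def)
  have "\<forall>\<^sub>F lam in at_right l. \<forall>j\<in>J. j \<noteq> k \<longrightarrow> D k + lam * k < D j + lam * j"
  proof (rule eventually_ball_finite[OF assms(1)], rule ballI)
    fix j
    \<comment> \<open>A strict inequality against a smaller \<open>j\<close> persists near
      \<open>l\<close> by continuity; against a larger \<open>j\<close> the gap grows by
      \<open>(lam - l) * (j - k)\<close>, which is positive to the right of
      \<open>l\<close>.\<close>
    assume j: "j \<in> J"
    show "\<forall>\<^sub>F lam in at_right l. j \<noteq> k \<longrightarrow> D k + lam * k < D j + lam * j"
    proof (cases "j < k")
      case True
      have lim: "((\<lambda>lam. (D j + lam * j) - (D k + lam * k)) \<longlongrightarrow> (D j + l * j) - (D k + l * k)) (at_right l)"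
        by (intro tendsto_intros)
      have "\<forall>\<^sub>F lam in at_right l. 0 < (D j + lam * j) - (D k + lam * k)"
        using l(2) j True by (intro order_tendstoD(1)[OF lim]) (auto simp: first_min_def)
      then show ?thesis
        by eventually_elim simp
    next
      case False
      have "\<forall>\<^sub>F lam in at_right l. l < lam"
        by (rule eventually_at_right_less)
      then show ?thesis
      proof eventually_elim
        case (elim lam)
        show ?case
        proof
          assume "j \<noteq> k"
          then have "k < j" using False by simp
          then have "0 < (lam - l) * (real j - real k)"
            using elim by simp
          moreover have "D k + l * k \<le> D j + l * j"
            using l(2) j \<open>k < j\<close> by (auto simp: first_min_def)
          ultimately show "D k + lam * k < D j + lam * j"
            by (simp add: algebra_simps)
        qed
      qed
    qed
  qed
  moreover have "\<forall>\<^sub>F lam in at_right l. l < lam"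
    by (rule eventually_at_right_less)
  ultimately have "\<forall>\<^sub>F lam in at_right l. l < lam \<and> (\<forall>j\<in>J. j \<noteq> k \<longrightarrow> D k + lam * k < D j + lam * j)"
    by eventually_elim simp
  then obtain lam where "l < lam" "\<forall>j\<in>J. j \<noteq> k \<longrightarrow> D k + lam * k < D j + lam * j"
    using eventually_happens'[OF trivial_limit_at_right_real] by blast
  then show ?thesis
    using l(1) that[of lam] by auto
qed

text \<open>
  Lines with larger \<open>j\<close> are less favourable for larger \<open>lam\<close>, so membership can be decided at the
  smallest \<open>l\<close> at which none of them lies below line \<open>k\<close>.
\<close>

lemma envelope_iff:
  fixes l :: real and D :: "nat \<Rightarrow> real"
  assumes "k \<in> J" and "0 \<le> l"
    and "\<And>j. j \<in> J \<Longrightarrow> k < j \<Longrightarrow> D k + l * k \<le> D j + l * j"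
    and "\<And>lam :: real. 0 \<le> lam \<Longrightarrow> (\<And>j. j \<in> J \<Longrightarrow> k < j \<Longrightarrow> D k + lam * k \<le> D j + lam * j) \<Longrightarrow> l \<le> lam"
  shows "k \<in> envelope J D \<longleftrightarrow> (\<forall>j\<in>J. j < k \<longrightarrow> D k + l * k < D j + l * j)"
proof
  assume "k \<in> envelope J D"
  then obtain lam where lam: "0 \<le> lam" "first_min J D lam k"
    by (auto simp: envelope_def)
  have "l \<le> lam"
    using lam by (intro assms(4)) (auto simp: first_min_def)
  show "\<forall>j\<in>J. j < k \<longrightarrow> D k + l * k < D j + l * j"
  proof (intro ballI impI)
    fix j
    assume "j \<in> J" "j < k"
    then have "D k + lam * k < D j + lam * j"
      using lam(2) by (auto simp: first_min_def)
    \<comment> \<open>Going down from \<open>lam\<close> to \<open>l\<close> lowers the steeper line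
      \<open>k\<close> by at least as much as line \<open>j\<close>.\<close>
    moreover have "0 \<le> (lam - l) * (real k - real j)"
      using \<open>l \<le> lam\<close> \<open>j < k\<close> by simp
    ultimately show "D k + l * k < D j + l * j"
      by (simp add: algebra_simps)
  qed
next
  assume "\<forall>j\<in>J. j < k \<longrightarrow> D k + l * k < D j + l * j"
  then show "k \<in> envelope J D"
    using assms(1-3) unfolding envelope_def first_min_def by blast
qed

section \<open>Walks and paths in digraphs with labelled arcs\<close>

text \<open>Both tables depend on the row, since the best predecessor depends on the number of edges
  left. The list has length \<open>i\<close> whatever the tables contain, so lists from different
  rows are distinct.\<close>

primrec backtrack :: "(nat \<Rightarrow> 'v \<Rightarrow> 'e) \<Rightarrow> (nat \<Rightarrow> 'v \<Rightarrow> 'v) \<Rightarrow> nat \<Rightarrow> 'v \<Rightarrow> 'e list" where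
  "backtrack lab prv 0 v = []"
| "backtrack lab prv (Suc i) v = backtrack lab prv i (prv (Suc i) v) @ [lab (Suc i) v]"

lemma length_backtrack [simp]: "length (backtrack lab prv i v) = i"
  by (induction i arbitrary: v) auto

text \<open>Arcs are traversals and labels are edges: \<open>lab\<close> is \<open>id\<close> for
  directed graphs and \<open>fst\<close> on \<open>bidirect G\<close> for undirected ones. The
  assumption keeps a path, which repeats no vertex, from using an edge in both directions.\<close>

locale labelled_digraph = fin_digraph H for H :: "('v, 'a) pre_digraph" (structure) +
  fixes lab :: "'a \<Rightarrow> 'e"
  assumes same_label: "\<lbrakk>a \<in> arcs H; b \<in> arcs H; lab a = lab b\<rbrakk> \<Longrightarrow> tail H a \<in> {tail H b, head H b}"
begin

definition step :: "'v \<Rightarrow> 'e \<Rightarrow> 'v \<Rightarrow> bool" where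
  "step u e v \<longleftrightarrow> (\<exists>a\<in>arcs H. lab a = e \<and> tail H a = u \<and> head H a = v)"

text \<open>If a later arc \<open>b\<close> had the label of the first arc \<open>a\<close>, the
  tail of \<open>a\<close> would be an end of \<open>b\<close> and thus be visited again.\<close>

lemma distinct_labels_apath:
  assumes "apath u q v"
  shows "distinct (map lab q)"
  using assms
proof (induction q arbitrary: u)
  case (Cons a q)
  have a: "a \<in> arcs H" "apath (head H a) q v" "tail H a \<notin> set (awalk_verts (head H a) q)"
    using Cons.prems by (auto simp: apath_Cons_iff)
  have "lab a \<noteq> lab b" if "b \<in> set q" for b
  proof
    assume "lab a = lab b"
    have aw: "awalk (head H a) q v"
      using a(2) by (rule awalkI_apath)
    then have "b \<in> arcs H"
      using that by (auto simp: awalk_def)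
    then have "tail H a \<in> {tail H b, head H b}"
      using same_label a(1) \<open>lab a = lab b\<close> by blast
    moreover have "{tail H b, head H b} \<subseteq> set (awalk_verts (head H a) q)"
      using that aw by (auto simp: set_awalk_verts)
    ultimately show False
      using a(3) by blast
  qed
  then show ?case
    using Cons.IH[OF a(2)] by auto
qed simp

text \<open>Cutting out a closed subwalk \<open>y\<close> shortens the walk and, as costs are
  nonnegative, does not make it dearer. The alternative \<open>q' = q\<close> records that a walk is
  shortened strictly unless it is a path already.\<close>

lemma shortcut_to_apath:
  fixes c :: "'e \<Rightarrow> real"
  assumes "awalk u q v" and "\<And>a. a \<in> arcs H \<Longrightarrow> 0 \<le> c (lab a)"
  obtains q' where "apath u q' v" "q' = q \<or> length q' < length q"
    "(\<Sum>a\<leftarrow>q'. c (lab a)) \<le> (\<Sum>a\<leftarrow>q. c (lab a))"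
proof -
  have "\<exists>q'. apath u q' v \<and> (q' = q \<or> length q' < length q) \<and>
    (\<Sum>a\<leftarrow>q'. c (lab a)) \<le> (\<Sum>a\<leftarrow>q. c (lab a))"
    using assms(1)
  proof (induction "length q" arbitrary: q rule: less_induct)
    case less
    show ?case
    proof (cases "distinct (awalk_verts u q)")
      case True
      then show ?thesis
        using less.prems by (intro exI[of _ q]) (auto simp: apath_def)
    next
      case False
      then obtain x y z w where q: "q = x @ y @ z" "0 < length y"
        and w: "awalk u x w" "awalk w y w" "awalk w z v"
        using awalk_not_distinct_decomp[OF less.prems] by blast
      have "awalk u (x @ z) v"
        using w by (blast intro: awalk_appendI)
      moreover have shorter: "length (x @ z) < length q"
        using q by simp
      ultimately obtain q' where q': "apath u q' v" "length q' \<le> length (x @ z)"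
        "(\<Sum>a\<leftarrow>q'. c (lab a)) \<le> (\<Sum>a\<leftarrow>(x @ z). c (lab a))"
        using less.hyps[of "x @ z"] by force
      have "0 \<le> (\<Sum>a\<leftarrow>y. c (lab a))"
        using w(2) assms(2) by (intro sum_list_nonneg) (auto simp: awalk_def)
      then show ?thesis
        using q(1) q' le_less_trans[OF q'(2) shorter] by (intro exI[of _ q'] conjI disjI2) simp_all
    qed
  qed
  then show ?thesis
    using that by blast
qed

end

section \<open>Tables of cheapest walks and the optimal set of paths\<close>

text \<open>The outcome of Bellman-Ford, detached from any program. \<open>sound\<close> makes every
  marked entry the cost of an actual walk, \<open>complete\<close> makes it a lower bound for all
  walks with \<open>i\<close> arcs. Rows below \<open>n\<close> suffice, because a path has fewer
  than \<open>n\<close> arcs.\<close>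

locale walk_table = labelled_digraph +
  fixes s t :: 'a and c :: "'c \<Rightarrow> real" and n :: nat
    and reach :: "nat \<Rightarrow> 'a \<Rightarrow> bool" and dist :: "nat \<Rightarrow> 'a \<Rightarrow> real"
    and last_edge :: "nat \<Rightarrow> 'a \<Rightarrow> 'c" and prev :: "nat \<Rightarrow> 'a \<Rightarrow> 'a"
  assumes ends: "s \<in> verts H" "t \<in> verts H" "s \<noteq> t" "\<exists>p. apath s p t"
    and card_verts: "card (verts H) = n"
    and cost_nonneg: "\<And>a. a \<in> arcs H \<Longrightarrow> 0 \<le> c (lab a)"
    and init: "\<And>v. v \<in> verts H \<Longrightarrow> reach 0 v \<longleftrightarrow> v = s" "dist 0 s = 0"
    and sound: "\<And>i v. Suc i < n \<Longrightarrow> v \<in> verts H \<Longrightarrow> reach (Suc i) v \<Longrightarrow>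
      step (prev (Suc i) v) (last_edge (Suc i) v) v \<and> reach i (prev (Suc i) v) \<and>
      dist (Suc i) v = dist i (prev (Suc i) v) + c (last_edge (Suc i) v)"
    and complete: "\<And>i u e v. Suc i < n \<Longrightarrow> step u e v \<Longrightarrow> reach i u \<Longrightarrow>
      reach (Suc i) v \<and> dist (Suc i) v \<le> dist i u + c e"
begin

text \<open>Induction from the end of the walk, with one use of \<open>complete\<close> per arc;
  \<open>walk_backtrack\<close> is the converse, obtained from \<open>sound\<close>.\<close>

lemma dist_le_walk:
  assumes "awalk s q v" and "length q < n"
  shows "reach (length q) v \<and> dist (length q) v \<le> (\<Sum>a\<leftarrow>q. c (lab a))"
  using assms
proof (induction q arbitrary: v rule: rev_induct)
  case Nil
  then show ?case
    using init ends by (auto simp: awalk_Nil_iff)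
next
  case (snoc a q)
  then have a: "awalk s q (tail H a)" "a \<in> arcs H" "head H a = v"
    by (auto simp: awalk_Cons_iff awalk_Nil_iff)
  then have "step (tail H a) (lab a) v"
    by (auto simp: step_def)
  moreover have "reach (length q) (tail H a)" "dist (length q) (tail H a) \<le> (\<Sum>a\<leftarrow>q. c (lab a))"
    using snoc.IH[OF a(1)] snoc.prems(2) by simp_all
  ultimately show ?case
    using complete[of "length q" "tail H a" "lab a" v] snoc.prems(2) by simp
qed

lemma walk_backtrack:
  assumes "i < n" "v \<in> verts H" "reach i v"
  shows "\<exists>q. awalk s q v \<and> map lab q = backtrack last_edge prev i v \<and>
    (\<Sum>a\<leftarrow>q. c (lab a)) = dist i v"
  using assms
proof (induction i arbitrary: v)
  case 0
  then show ?case
    using init ends by (auto simp: awalk_Nil_iff intro!: exI[of _ "[]"])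
next
  case (Suc i)
  obtain a where a: "a \<in> arcs H" "lab a = last_edge (Suc i) v" "tail H a = prev (Suc i) v" "head H a = v"
    and i: "reach i (prev (Suc i) v)" "dist (Suc i) v = dist i (prev (Suc i) v) + c (last_edge (Suc i) v)"
    using sound[OF Suc.prems] by (auto simp: step_def)
  have "prev (Suc i) v \<in> verts H"
    using a by (metis tail_in_verts)
  then obtain q where q: "awalk s q (prev (Suc i) v)"
    "map lab q = backtrack last_edge prev i (prev (Suc i) v)"
    "(\<Sum>a\<leftarrow>q. c (lab a)) = dist i (prev (Suc i) v)"
    using Suc.IH i(1) Suc.prems(1) by auto
  have "awalk s (q @ [a]) v"
    using a by (intro awalk_appendI[OF q(1)]) (auto simp: awalk_Cons_iff awalk_Nil_iff)
  then show ?case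
    using q a i(2) by (intro exI[of _ "q @ [a]"]) simp
qed

definition lengths :: "nat set" where
  "lengths = {k. k < n \<and> reach k t}"

definition paths :: "'c list set" where
  "paths = map lab ` {q. apath s q t}"

definition solution :: "'c list set" where
  "solution = (\<lambda>k. backtrack last_edge prev k t) ` envelope lengths (\<lambda>k. dist k t)"

lemma finite_lengths: "finite lengths"
  by (simp add: lengths_def)

text \<open>A path is a walk with fewer than \<open>n\<close> arcs and without repeated labels, so
  \<open>dist_le_walk\<close> applies. Only an inequality results, because a walk with cycles may be
  cheaper than every path with as many arcs.\<close>

lemma pathsE:
  assumes "p \<in> paths"
  shows "set p \<subseteq> lab ` arcs H" "card (set p) = length p" "path_cost c p = sum_list (map c p)"
    "length p \<in> lengths" "dist (length p) t \<le> path_cost c p"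
proof -
  obtain q where q: "apath s q t" "p = map lab q"
    using assms by (auto simp: paths_def)
  then have aw: "awalk s q t" and "distinct p"
    using distinct_labels_apath by (auto intro: awalkI_apath)
  then show "card (set p) = length p" and *: "path_cost c p = sum_list (map c p)"
    by (simp_all add: distinct_card path_cost_def sum_list_distinct_conv_sum_set)
  show "set p \<subseteq> lab ` arcs H"
    using aw q(2) by (auto simp: awalk_def)
  have "length q < n"
    using length_apath_less[OF q(1)] card_verts by simp
  then show "length p \<in> lengths" "dist (length p) t \<le> path_cost c p"
    using dist_le_walk[OF aw] q(2) * by (simp_all add: lengths_def comp_def)
qed

lemma worst_cost_path:
  assumes "p \<in> paths" "0 \<le> lam"
  shows "worst_cost (uncertainty_set c lam (unit_box (lab ` arcs H))) p = path_cost c p + lam * length p"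
  using worst_cost_unit_box[of p] pathsE[OF assms(1)] assms(2) by simp

lemma lengths_nonempty: "lengths \<noteq> {}"
  using ends(4) pathsE(4) by (auto simp: paths_def)

text \<open>Were the walk not a path, shortcutting would give a path with fewer arcs and no larger
  cost. Its length is then a smaller index with a value at most that of \<open>k\<close>, against
  the strict half of \<open>first_min\<close>.\<close>

lemma backtrack_path:
  assumes "0 \<le> lam" "first_min lengths (\<lambda>k. dist k t) lam k"
  shows "backtrack last_edge prev k t \<in> paths"
    and "path_cost c (backtrack last_edge prev k t) = dist k t"
proof -
  let ?p = "backtrack last_edge prev k t"
  have k: "k < n" "reach k t"
    using assms(2) by (auto simp: first_min_def lengths_def)
  then obtain q where q: "awalk s q t" "map lab q = ?p" "(\<Sum>a\<leftarrow>q. c (lab a)) = dist k t"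
    using walk_backtrack[of k t] ends by auto
  obtain q' where q': "apath s q' t" "q' = q \<or> length q' < length q"
    "(\<Sum>a\<leftarrow>q'. c (lab a)) \<le> (\<Sum>a\<leftarrow>q. c (lab a))"
    using shortcut_to_apath[OF q(1), of c] cost_nonneg by blast
  have "length q = k"
    using arg_cong[OF q(2), of length] by simp
  have "map lab q' \<in> paths"
    using q'(1) by (auto simp: paths_def)
  have "\<not> length q' < length q"
  proof
    assume less: "length q' < length q"
    then have "dist k t + lam * k < dist (length q') t + lam * length q'"
      using assms(2) pathsE(4)[OF \<open>map lab q' \<in> paths\<close>] \<open>length q = k\<close> by (auto simp: first_min_def)
    moreover have "dist (length q') t \<le> dist k t"
      using pathsE(3,5)[OF \<open>map lab q' \<in> paths\<close>] q'(3) q(3) by (simp add: comp_def)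
    moreover have "lam * length q' \<le> lam * k"
      using less \<open>length q = k\<close> assms(1) by (intro mult_left_mono) auto
    ultimately show False
      by simp
  qed
  then have "q' = q"
    using q'(2) by blast
  then show "?p \<in> paths"
    using \<open>map lab q' \<in> paths\<close> q(2) by simp
  then show "path_cost c ?p = dist k t"
    using pathsE(3)[of ?p] q(3) by (simp add: comp_def flip: q(2))
qed

lemma solution_covers: "covers_all_sizes paths c (unit_box (lab ` arcs H)) solution"
  unfolding covers_all_sizes_def
proof (intro conjI allI impI)
  have "envelope lengths (\<lambda>k. dist k t) \<subseteq> lengths"
    by (auto simp: envelope_def first_min_def)
  then show "finite solution"
    unfolding solution_def using finite_lengths by (auto intro: finite_subset)
  show "solution \<subseteq> paths"
    unfolding solution_def envelope_def using backtrack_path(1) by blast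
  fix lam :: real
  assume lam: "0 \<le> lam"
  obtain k where k: "first_min lengths (\<lambda>k. dist k t) lam k"
    using first_min_exists[OF finite_lengths lengths_nonempty] .
  let ?p = "backtrack last_edge prev k t"
  have p: "?p \<in> paths" "path_cost c ?p = dist k t"
    using backtrack_path[OF lam k] .
  have "path_cost c ?p + lam * length ?p \<le> path_cost c q + lam * length q" if "q \<in> paths" for q
    using first_min_le[OF k pathsE(4)[OF that]] pathsE(5)[OF that] p(2) by simp
  then have "robust_optimal paths c (unit_box (lab ` arcs H)) lam ?p"
    unfolding robust_optimal_def is_arg_min_linorder
    using p(1) lam by (simp add: worst_cost_path)
  moreover have "?p \<in> solution"
    using k lam by (auto simp: solution_def envelope_def)
  ultimately show "\<exists>p\<in>solution. robust_optimal paths c (unit_box (lab ` arcs H)) lam p"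
    by blast
qed

text \<open>At a \<open>lam\<close> where \<open>k\<close> is the only minimiser, every optimal path
  has exactly \<open>k\<close> arcs. The lengths occurring in a covering set therefore include the
  whole envelope.\<close>

lemma card_envelope_le:
  assumes "covers_all_sizes paths c (unit_box (lab ` arcs H)) S"
  shows "card (envelope lengths (\<lambda>k. dist k t)) \<le> card S"
proof -
  have "finite S" "S \<subseteq> paths"
    using assms by (auto simp: covers_all_sizes_def)
  have "envelope lengths (\<lambda>k. dist k t) \<subseteq> length ` S"
  proof
    fix k
    assume k: "k \<in> envelope lengths (\<lambda>k. dist k t)"
    obtain l where "0 \<le> l" "first_min lengths (\<lambda>k. dist k t) l k"
      using k by (auto simp: envelope_def)
    note b = backtrack_path[OF this]
    obtain lam :: real where lam: "0 < lam"
      "\<And>j. j \<in> lengths \<Longrightarrow> j \<noteq> k \<Longrightarrow> dist k t + lam * k < dist j t + lam * j"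
      using envelope_strict_min[OF finite_lengths k] by blast
    have "\<exists>p\<in>S. robust_optimal paths c (unit_box (lab ` arcs H)) lam p"
      using assms lam(1) by (simp add: covers_all_sizes_def)
    then obtain p where p: "p \<in> S" "robust_optimal paths c (unit_box (lab ` arcs H)) lam p"
      by blast
    have "p \<in> paths"
      using p(1) \<open>S \<subseteq> paths\<close> by blast
    let ?w = "worst_cost (uncertainty_set c lam (unit_box (lab ` arcs H)))"
    have "?w p \<le> ?w (backtrack last_edge prev k t)"
      using p(2) b(1) unfolding robust_optimal_def is_arg_min_linorder by blast
    then have "path_cost c p + lam * length p \<le> dist k t + lam * k"
      using b \<open>p \<in> paths\<close> lam(1) by (simp add: worst_cost_path)
    then have "length p = k"
      using lam(2)[of "length p"] pathsE(4,5)[OF \<open>p \<in> paths\<close>] by fastforce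
    then show "k \<in> length ` S"
      using p(1) by blast
  qed
  then show ?thesis
    using \<open>finite S\<close> by (rule surj_card_le[rotated])
qed

lemma card_solution: "card solution = card (envelope lengths (\<lambda>k. dist k t))"
proof -
  have "inj_on (\<lambda>k. backtrack last_edge prev k t) A" for A
    by (rule inj_onI) (metis length_backtrack)
  then show ?thesis
    unfolding solution_def by (rule card_image)
qed

theorem solution_optimal:
  "variable_sized_solution paths c (unit_box (lab ` arcs H)) solution" "card solution \<le> n"
proof -
  show "variable_sized_solution paths c (unit_box (lab ` arcs H)) solution"
    unfolding variable_sized_solution_def is_arg_min_linorder
    using solution_covers card_envelope_le by (auto simp: card_solution)
  have "envelope lengths (\<lambda>k. dist k t) \<subseteq> {..<n}"
    by (auto simp: envelope_def first_min_def lengths_def)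
  then show "card solution \<le> n"
    unfolding card_solution using card_mono[of "{..<n}"] by fastforce
qed

end

section \<open>Total correctness and running time of while-programs\<close>

definition triple :: "(ram_state \<Rightarrow> bool) \<Rightarrow> com \<Rightarrow> nat \<Rightarrow> (ram_state \<Rightarrow> bool) \<Rightarrow> bool" where
  "triple P c B Q \<longleftrightarrow> (\<forall>\<sigma>. P \<sigma> \<longrightarrow> (\<exists>T \<tau>. exec c \<sigma> T \<tau> \<and> T \<le> B \<and> Q \<tau>))"

lemma triple_weaken:
  assumes "triple P' c B' Q'" "\<And>\<sigma>. P \<sigma> \<Longrightarrow> P' \<sigma>" "B' \<le> B" "\<And>\<sigma>. Q' \<sigma> \<Longrightarrow> Q \<sigma>"
  shows "triple P c B Q"
  using assms unfolding triple_def by (meson order_trans)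

lemma triple_Seq:
  assumes "triple P c B R" "triple R d B' Q"
  shows "triple P (Seq c d) (B + B') Q"
  using assms unfolding triple_def by (meson exec.Seq add_mono)

fun loop_free :: "com \<Rightarrow> bool" where
  "loop_free (Seq c d) \<longleftrightarrow> loop_free c \<and> loop_free d"
| "loop_free (If b c d) \<longleftrightarrow> loop_free c \<and> loop_free d"
| "loop_free (While b c) \<longleftrightarrow> False"
| "loop_free _ \<longleftrightarrow> True"

text \<open>For loop-free code \<open>run\<close> and \<open>max_cost\<close> replace derivations of
  \<open>exec\<close> by simplification. The clauses for \<open>While\<close> are default values;
  \<open>exec_run\<close> excludes loops.\<close>

fun run :: "com \<Rightarrow> ram_state \<Rightarrow> ram_state" where
  "run Skip \<sigma> = \<sigma>"
| "run (NAssign x u) \<sigma> = \<sigma>\<lparr>nvar := (nvar \<sigma>)(x := nval u \<sigma>)\<rparr>"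
| "run (NStore a i u) \<sigma> = \<sigma>\<lparr>narr := (narr \<sigma>)(a := (narr \<sigma> a)(nval i \<sigma> := nval u \<sigma>))\<rparr>"
| "run (RAssign x r) \<sigma> = \<sigma>\<lparr>rvar := (rvar \<sigma>)(x := rval r \<sigma>)\<rparr>"
| "run (RStore a i r) \<sigma> = \<sigma>\<lparr>rarr := (rarr \<sigma>)(a := (rarr \<sigma> a)(nval i \<sigma> := rval r \<sigma>))\<rparr>"
| "run (Seq c d) \<sigma> = run d (run c \<sigma>)"
| "run (If b c d) \<sigma> = (if bval b \<sigma> then run c \<sigma> else run d \<sigma>)"
| "run (While b c) \<sigma> = \<sigma>"

fun max_cost :: "com \<Rightarrow> nat" where
  "max_cost Skip = 1"
| "max_cost (NAssign x u) = 1 + ncost u"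
| "max_cost (NStore a i u) = 1 + ncost i + ncost u"
| "max_cost (RAssign x r) = 1 + rcost r"
| "max_cost (RStore a i r) = 1 + ncost i + rcost r"
| "max_cost (Seq c d) = max_cost c + max_cost d"
| "max_cost (If b c d) = 1 + bcost b + (max_cost c + max_cost d)"
| "max_cost (While b c) = 0"

lemma exec_run:
  assumes "loop_free c"
  shows "\<exists>T. exec c \<sigma> T (run c \<sigma>) \<and> T \<le> max_cost c"
  using assms
proof (induction c arbitrary: \<sigma>)
  case (Seq c d)
  then obtain T U where "exec c \<sigma> T (run c \<sigma>)" "T \<le> max_cost c"
    "exec d (run c \<sigma>) U (run d (run c \<sigma>))" "U \<le> max_cost d"
    by (metis loop_free.simps(1))
  then show ?case
    using exec.Seq by (intro exI[of _ "T + U"]) auto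
next
  case (If b c d)
  then obtain T U where "exec c \<sigma> T (run c \<sigma>)" "T \<le> max_cost c"
    "exec d \<sigma> U (run d \<sigma>)" "U \<le> max_cost d"
    by (metis loop_free.simps(2))
  then show ?case
    using exec.IfTrue[of b \<sigma> c T "run c \<sigma>" d] exec.IfFalse[of b \<sigma> d U "run d \<sigma>" c]
    by (intro exI[of _ "1 + bcost b + (if bval b \<sigma> then T else U)"]) auto
next
  case Skip
  show ?case using exec.Skip[of \<sigma>] by auto
next
  case (NAssign x u)
  show ?case using exec.NAssign[of x u \<sigma>] by auto
next
  case (NStore a i u)
  show ?case using exec.NStore[of a i u \<sigma>] by auto
next
  case (RAssign x r)
  show ?case using exec.RAssign[of x r \<sigma>] by auto
next
  case (RStore a i r)
  show ?case using exec.RStore[of a i r \<sigma>] by auto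
qed simp

lemma triple_run:
  assumes "loop_free c" "max_cost c \<le> B" "\<And>\<sigma>. P \<sigma> \<Longrightarrow> Q (run c \<sigma>)"
  shows "triple P c B Q"
  using assms exec_run unfolding triple_def by (meson order_trans)

text \<open>Indexing the invariant by a round counter yields termination and time together:
  \<open>n - i\<close> rounds remain. The counter need not be a program variable, and
  \<open>Suc n\<close> accounts for the final failing test.\<close>

lemma triple_For:
  assumes "\<And>i. i < n \<Longrightarrow> triple (I i) c B (I (Suc i))"
    and "\<And>i \<sigma>. I i \<sigma> \<Longrightarrow> bval b \<sigma> \<longleftrightarrow> i < n"
    and "i0 \<le> n"
  shows "triple (I i0) (While b c) (Suc n * (1 + bcost b + B)) (I n)"
proof -
  have "\<exists>T \<tau>. exec (While b c) \<sigma> T \<tau> \<and> T \<le> Suc (n - i) * (1 + bcost b + B) \<and> I n \<tau>"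
    if "i \<le> n" "I i \<sigma>" for \<sigma> i
    using that
  proof (induction i arbitrary: \<sigma> rule: inc_induct)
    case base
    then have "\<not> bval b \<sigma>"
      using assms(2) by blast
    then show ?case
      using base exec.WhileFalse[of b \<sigma> c] by fastforce
  next
    case (step i)
    then have b: "bval b \<sigma>"
      using assms(2) by blast
    obtain m \<rho> where \<rho>: "exec c \<sigma> m \<rho>" "m \<le> B" "I (Suc i) \<rho>"
      using assms(1)[OF step.hyps(2)] step.prems unfolding triple_def by blast
    then obtain T \<tau> where T: "exec (While b c) \<rho> T \<tau>" "T \<le> Suc (n - Suc i) * (1 + bcost b + B)" "I n \<tau>"
      using step.IH by blast
    have "exec (While b c) \<sigma> (1 + bcost b + m + T) \<tau>"
      using exec.WhileTrue[OF b \<rho>(1) T(1)] .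
    moreover have "n - i = Suc (n - Suc i)"
      using step.hyps(2) by simp
    ultimately show ?case
      using \<rho>(2) T by (intro exI[of _ "1 + bcost b + m + T"] exI[of _ \<tau>]) simp
  qed
  moreover have "Suc (n - i0) * (1 + bcost b + B) \<le> Suc n * (1 + bcost b + B)"
    by (intro mult_right_mono) auto
  ultimately show ?thesis
    unfolding triple_def using assms(3) by (meson order_trans)
qed

section \<open>Bellman--Ford tables\<close>

text \<open>
  Row \<open>i\<close> and column \<open>v\<close> of a table are stored at \<open>i * N + v\<close>.  An entry of \<open>ed\<close> is the last edge of
  the walk plus \<open>1\<close>; the initial value \<open>0\<close> means that no walk has been found.
\<close>

definition level :: "nat \<Rightarrow> (nat \<times> nat \<times> nat) set \<Rightarrow> (nat \<Rightarrow> real) \<Rightarrow>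
    (nat \<Rightarrow> nat) \<Rightarrow> (nat \<Rightarrow> nat) \<Rightarrow> (nat \<Rightarrow> real) \<Rightarrow> nat \<Rightarrow> bool" where
  "level N E c ed pr ds i \<longleftrightarrow>
     (\<forall>v<N. 0 < ed (Suc i * N + v) \<longrightarrow>
        (pr (Suc i * N + v), ed (Suc i * N + v) - 1, v) \<in> E \<and>
        0 < ed (i * N + pr (Suc i * N + v)) \<and>
        ds (Suc i * N + v) = ds (i * N + pr (Suc i * N + v)) + c (ed (Suc i * N + v) - 1)) \<and>
     (\<forall>(u, e, v)\<in>E. 0 < ed (i * N + u) \<longrightarrow>
        0 < ed (Suc i * N + v) \<and> ds (Suc i * N + v) \<le> ds (i * N + u) + c e)"

text \<open>The invariant while row \<open>Suc k\<close> is being filled: earlier levels are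
  finished for all steps in \<open>E\<close>, the current one only for the steps \<open>F\<close>
  relaxed so far. Later rows are still zero.\<close>

definition table :: "nat \<Rightarrow> nat \<Rightarrow> (nat \<times> nat \<times> nat) set \<Rightarrow> (nat \<Rightarrow> real) \<Rightarrow> (nat \<times> nat \<times> nat) set \<Rightarrow>
    (nat \<Rightarrow> nat) \<Rightarrow> (nat \<Rightarrow> nat) \<Rightarrow> (nat \<Rightarrow> real) \<Rightarrow> nat \<Rightarrow> bool" where
  "table N s E c F ed pr ds k \<longleftrightarrow>
     (\<forall>v<N. 0 < ed v \<longleftrightarrow> v = s) \<and> ds s = 0 \<and>
     (\<forall>i<k. level N E c ed pr ds i) \<and> level N F c ed pr ds k \<and>
     (\<forall>x\<ge>Suc (Suc k) * N. ed x = 0)"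

lemma row_less:
  fixes v :: nat
  assumes "v < N" "i \<le> k"
  shows "i * N + v < Suc k * N"
proof -
  have "i * N + v < Suc i * N" using assms(1) by simp
  also have "\<dots> \<le> Suc k * N" using assms(2) by (intro mult_right_mono) auto
  finally show ?thesis .
qed

text \<open>A level refers to rows \<open>i\<close> and \<open>Suc i\<close> only: the stored
  predecessors are vertices by the bound on \<open>E\<close>, so looking them up stays within row
  \<open>i\<close>.\<close>

lemma level_cong:
  assumes "\<And>x. x < Suc (Suc i) * N \<Longrightarrow> ed' x = ed x \<and> pr' x = pr x \<and> ds' x = ds x"
    and "\<And>u e v. (u, e, v) \<in> E \<Longrightarrow> u < N \<and> v < N"
    and "level N E c ed pr ds i"
  shows "level N E c ed' pr' ds' i"
proof -
  have 1: "ed' (j * N + v) = ed (j * N + v)" "pr' (j * N + v) = pr (j * N + v)"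
    "ds' (j * N + v) = ds (j * N + v)" if "v < N" "j \<le> Suc i" for v j
    using assms(1)[OF row_less[OF that]] by auto
  have sound: "(pr (Suc i * N + v), ed (Suc i * N + v) - 1, v) \<in> E"
      "0 < ed (i * N + pr (Suc i * N + v))"
      "ds (Suc i * N + v) = ds (i * N + pr (Suc i * N + v)) + c (ed (Suc i * N + v) - 1)"
    if "v < N" "0 < ed (Suc i * N + v)" for v
    using assms(3) that unfolding level_def by blast+
  have complete: "0 < ed (Suc i * N + v) \<and> ds (Suc i * N + v) \<le> ds (i * N + u) + c e"
    if "(u, e, v) \<in> E" "0 < ed (i * N + u)" for u e v
    using assms(3) that unfolding level_def by blast
  show ?thesis
    unfolding level_def
  proof (intro conjI allI impI ballI)
    fix v
    assume v: "v < N" "0 < ed' (Suc i * N + v)"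
    then have v': "0 < ed (Suc i * N + v)"
      using 1(1)[of v "Suc i"] by simp
    note * = sound[OF v(1) v']
    have u: "pr (Suc i * N + v) < N"
      using assms(2) *(1) by blast
    note eqs = 1[OF v(1) order_refl] 1[OF u, of i]
    show "(pr' (Suc i * N + v), ed' (Suc i * N + v) - 1, v) \<in> E"
      unfolding eqs by (rule *(1))
    show "0 < ed' (i * N + pr' (Suc i * N + v))"
      unfolding eqs using *(2) eqs(4) by simp
    show "ds' (Suc i * N + v) = ds' (i * N + pr' (Suc i * N + v)) + c (ed' (Suc i * N + v) - 1)"
      unfolding eqs using *(3) eqs(6) by simp
  next
    fix x
    assume "x \<in> E"
    moreover obtain u e v where x: "x = (u, e, v)"
      by (cases x)
    ultimately have E: "(u, e, v) \<in> E"
      by simp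
    then have uv: "u < N" "v < N"
      using assms(2) by blast+
    show "case x of (u, e, v) \<Rightarrow> 0 < ed' (i * N + u) \<longrightarrow>
        0 < ed' (Suc i * N + v) \<and> ds' (Suc i * N + v) \<le> ds' (i * N + u) + c e"
      unfolding x prod.case using complete[OF E] 1[OF uv(1), of i] 1[OF uv(2), of "Suc i"] by simp
  qed
qed

text \<open>Used to see that writing into row \<open>Suc k\<close> leaves the finished levels
  intact.\<close>

lemma table_cong_rows:
  assumes "\<And>x. x < Suc k * N \<Longrightarrow> ed' x = ed x \<and> pr' x = pr x \<and> ds' x = ds x"
    and "\<And>u e v. (u, e, v) \<in> E \<Longrightarrow> u < N \<and> v < N"
    and "\<forall>i<k. level N E c ed pr ds i"
  shows "\<forall>i<k. level N E c ed' pr' ds' i"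
proof (intro allI impI)
  fix i
  assume "i < k"
  have "x < Suc k * N" if "x < Suc (Suc i) * N" for x
    using that \<open>i < k\<close> mult_le_mono1[of "Suc (Suc i)" "Suc k" N] by simp
  then show "level N E c ed' pr' ds' i"
    using assms \<open>i < k\<close> by (intro level_cong[of i N ed' ed pr' pr ds' ds E c]) auto
qed

text \<open>The next row is still zero, so its level holds vacuously for the empty set of
  steps.\<close>

lemma table_next_row:
  assumes "table N s E c E ed pr ds k" "0 < N"
  shows "table N s E c {} ed pr ds (Suc k)"
proof -
  have "ed x = 0" if "Suc (Suc k) * N \<le> x" for x
    using assms that by (auto simp: table_def)
  then have "level N {} c ed pr ds (Suc k)" "\<forall>x\<ge>Suc (Suc (Suc k)) * N. ed x = 0"
    by (auto simp: level_def)
  then show ?thesis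
    using assms(1) by (auto simp: table_def less_Suc_eq)
qed

lemma table_relax_skip:
  assumes "table N s E c F ed pr ds k"
    and "0 < ed (k * N + u) \<Longrightarrow> 0 < ed (Suc k * N + v) \<and> ds (Suc k * N + v) \<le> ds (k * N + u) + c e"
  shows "table N s E c (insert (u, e, v) F) ed pr ds k"
  using assms by (auto simp: table_def level_def)

text \<open>Cell \<open>q\<close> lies in row \<open>Suc k\<close>, so row \<open>k\<close>, from
  which distances are read, is unchanged. The new step justifies the entry at \<open>q\<close>, and
  earlier steps into \<open>v\<close> stay satisfied because an existing entry only
  decreases.\<close>

lemma table_relax_update:
  assumes tab: "table N s E c F ed pr ds k"
    and E: "\<And>u e v. (u, e, v) \<in> E \<Longrightarrow> u < N \<and> v < N"
    and F: "\<And>u e v. (u, e, v) \<in> F \<Longrightarrow> u < N \<and> v < N"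
    and "s < N" "u < N" "v < N"
    and q: "q = Suc k * N + v"
    and p: "0 < ed (k * N + u)" "0 < ed q \<Longrightarrow> ds (k * N + u) + c e < ds q"
  shows "table N s E c (insert (u, e, v) F) (ed(q := Suc e)) (pr(q := u)) (ds(q := ds (k * N + u) + c e)) k"
    (is "table N s E c ?F ?ed ?pr ?ds k")
proof -
  have low: "k * N + w \<noteq> q" if "w < N" for w
    using row_less[OF that order_refl, of k] q by simp
  have row: "Suc k * N + w = q \<longleftrightarrow> w = v" for w
    using q by simp
  have small: "x < Suc k * N \<Longrightarrow> x \<noteq> q" for x
    using q by simp
  have lev: "level N F c ed pr ds k"
    using tab by (simp add: table_def)
  have 0: "\<forall>v<N. 0 < ?ed v \<longleftrightarrow> v = s" "?ds s = 0"
    using tab q \<open>s < N\<close> by (auto simp: table_def)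
  have 1: "\<forall>i<k. level N E c ?ed ?pr ?ds i"
    using tab E small by (intro table_cong_rows[of k N ?ed ed ?pr pr ?ds ds]) (auto simp: table_def)
  have 2: "level N ?F c ?ed ?pr ?ds k"
    unfolding level_def
  proof (intro conjI allI impI ballI)
    fix w
    assume w: "w < N" "0 < ?ed (Suc k * N + w)"
    have "(?pr (Suc k * N + w), ?ed (Suc k * N + w) - 1, w) \<in> ?F \<and>
       0 < ?ed (k * N + ?pr (Suc k * N + w)) \<and>
       ?ds (Suc k * N + w) = ?ds (k * N + ?pr (Suc k * N + w)) + c (?ed (Suc k * N + w) - 1)"
    proof (cases "w = v")
      case True
      then show ?thesis
        using p(1) low[OF \<open>u < N\<close>] q by simp
    next
      case False
      then have "0 < ed (Suc k * N + w)"
        using w(2) row by simp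
      then have old: "(pr (Suc k * N + w), ed (Suc k * N + w) - 1, w) \<in> F"
        "0 < ed (k * N + pr (Suc k * N + w))"
        "ds (Suc k * N + w) = ds (k * N + pr (Suc k * N + w)) + c (ed (Suc k * N + w) - 1)"
        using lev w(1) unfolding level_def by blast+
      then have "k * N + pr (Suc k * N + w) \<noteq> q"
        using F low by blast
      then show ?thesis
        using old False row[of w] by simp
    qed
    then show "(?pr (Suc k * N + w), ?ed (Suc k * N + w) - 1, w) \<in> ?F"
       "0 < ?ed (k * N + ?pr (Suc k * N + w))"
       "?ds (Suc k * N + w) = ?ds (k * N + ?pr (Suc k * N + w)) + c (?ed (Suc k * N + w) - 1)"
      by blast+
  next
    fix x
    assume "x \<in> ?F"
    obtain u' e' v' where x: "x = (u', e', v')"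
      by (cases x)
    have "0 < ?ed (Suc k * N + v') \<and> ?ds (Suc k * N + v') \<le> ?ds (k * N + u') + c e'"
      if r: "0 < ?ed (k * N + u')"
    proof (cases "(u', e', v') \<in> F")
      case True
      then have "k * N + u' \<noteq> q"
        using F low by blast
      then have "0 < ed (Suc k * N + v') \<and> ds (Suc k * N + v') \<le> ds (k * N + u') + c e'"
        using lev True r unfolding level_def by auto
      then show ?thesis
        using p(2) row[of v'] \<open>k * N + u' \<noteq> q\<close> q by (cases "v' = v") auto
    next
      case False
      then have "u' = u" "e' = e" "v' = v"
        using \<open>x \<in> ?F\<close> x by auto
      then show ?thesis
        using low[OF \<open>u < N\<close>] q by simp
    qed
    then show "case x of (u', e', v') \<Rightarrow> 0 < ?ed (k * N + u') \<longrightarrow>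
        0 < ?ed (Suc k * N + v') \<and> ?ds (Suc k * N + v') \<le> ?ds (k * N + u') + c e'"
      unfolding x prod.case by blast
  qed
  have "\<forall>x\<ge>Suc (Suc k) * N. ?ed x = 0"
    using tab q \<open>v < N\<close> by (auto simp: table_def)
  then show ?thesis
    unfolding table_def using 0 1 2 by blast
qed

section \<open>The program that fills the table\<close>

fun seqs :: "com list \<Rightarrow> com" where
  "seqs [] = Skip"
| "seqs (c # cs) = Seq c (seqs cs)"

text \<open>\<open>''a''\<close> and \<open>''b''\<close> are the offsets of the old and the new
  row. The nested negations express a disjunction, which \<open>bexp\<close> does not have: the new
  cell is empty or gets cheaper.\<close>

definition relax :: "name \<Rightarrow> name \<Rightarrow> com" where
  "relax X Y = seqs
     [NAssign ''u'' (NArr X (NVar ''e'')),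
      NAssign ''v'' (NArr Y (NVar ''e'')),
      NAssign ''p'' (NAdd (NVar ''a'') (NVar ''u'')),
      NAssign ''q'' (NAdd (NVar ''b'') (NVar ''v'')),
      RAssign ''d'' (RAdd (RArr ''dist'' (NVar ''p'')) (RArr ''cost'' (NVar ''e''))),
      If (Conj (NLess (NConst 0) (NArr ''edge'' (NVar ''p'')))
           (Neg (Conj (NLess (NConst 0) (NArr ''edge'' (NVar ''q'')))
             (Neg (RLess (RVar ''d'') (RArr ''dist'' (NVar ''q'')))))))
        (seqs
          [NStore ''edge'' (NVar ''q'') (NAdd (NVar ''e'') (NConst 1)),
           NStore ''prev'' (NVar ''q'') (NVar ''u''),
           RStore ''dist'' (NVar ''q'') (RVar ''d'')])
        Skip]"

text \<open>
  For directed graphs the second relaxation of an edge just repeats the first one, so that one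
  correctness proof covers both kinds.
\<close>

fun second_tail second_head :: "graph_kind \<Rightarrow> name" where
  "second_tail Directed = ''tail''"
| "second_tail Undirected = ''head''"
| "second_head Directed = ''head''"
| "second_head Undirected = ''tail''"

definition scan_edges :: "graph_kind \<Rightarrow> com" where
  "scan_edges kind = While (NLess (NVar ''e'') (NVar ''M''))
     (Seq (relax ''tail'' ''head'') (Seq (relax (second_tail kind) (second_head kind))
       (NAssign ''e'' (NAdd (NVar ''e'') (NConst 1)))))"

text \<open>\<open>''X''\<close> tabulates the reals \<open>0, 1, 2, \<dots>\<close>, as naturals cannot be converted to reals.\<close>

definition record_column :: com where
  "record_column = seqs
     [NAssign ''p'' (NAdd (NVar ''b'') (NVar ''t'')),
      NStore ''reach'' (NVar ''k'') (NArr ''edge'' (NVar ''p'')),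
      RStore ''D'' (NVar ''k'') (RArr ''dist'' (NVar ''p'')),
      RStore ''X'' (NVar ''k'') (RVar ''x'')]"

text \<open>The entry \<open>1\<close> for \<open>s\<close> in row \<open>0\<close> only marks
  \<open>s\<close> as reached; backtracking stops before reading it as an edge. Row offsets advance
  by addition, as the machine cannot multiply naturals.\<close>

definition fill_table :: "graph_kind \<Rightarrow> com" where
  "fill_table kind = Seq
     (seqs
       [NStore ''edge'' (NVar ''s'') (NConst 1),
        record_column,
        NAssign ''k'' (NConst 1),
        NAssign ''b'' (NVar ''N''),
        RAssign ''x'' (RConst 1)])
     (While (NLess (NVar ''k'') (NVar ''N''))
       (Seq (NAssign ''e'' (NConst 0)) (Seq (scan_edges kind)
         (seqs
           [record_column,
            NAssign ''k'' (NAdd (NVar ''k'') (NConst 1)),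
            NAssign ''a'' (NVar ''b''),
            NAssign ''b'' (NAdd (NVar ''b'') (NVar ''N'')),
            RAssign ''x'' (RAdd (RVar ''x'') (RConst 1))]))))"

locale program_input =
  fixes kind :: graph_kind and N M s t :: nat and tl hd :: "nat \<Rightarrow> nat" and c :: "nat \<Rightarrow> real"
  assumes s: "s < N" and t: "t < N"
    and ends: "\<And>e. e < M \<Longrightarrow> tl e < N \<and> hd e < N"
begin

definition steps :: "nat \<Rightarrow> (nat \<times> nat \<times> nat) set" where
  "steps m = {(tl e, e, hd e) | e. e < m} \<union> (if kind = Undirected then {(hd e, e, tl e) | e. e < m} else {})"

lemma steps_less: "(u, e, v) \<in> steps m \<Longrightarrow> m \<le> M \<Longrightarrow> u < N \<and> v < N"
  using ends by (auto simp: steps_def split: if_splits)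

text \<open>The two insertions are the two relaxations of edge \<open>m\<close> in the loop body;
  for directed graphs they coincide.\<close>

lemma steps_Suc:
  "steps (Suc m) = insert
    (if kind = Directed then tl m else hd m, m, if kind = Directed then hd m else tl m) (insert (tl m, m, hd m) (steps m))"
  unfolding steps_def by (cases kind) (auto simp: less_Suc_eq)

definition input :: "ram_state \<Rightarrow> bool" where
  "input \<sigma> \<longleftrightarrow> nvar \<sigma> ''N'' = N \<and> nvar \<sigma> ''M'' = M \<and> nvar \<sigma> ''s'' = s \<and> nvar \<sigma> ''t'' = t \<and>
     narr \<sigma> ''tail'' = tl \<and> narr \<sigma> ''head'' = hd \<and> rarr \<sigma> ''cost'' = c"

definition columns :: "nat \<Rightarrow> ram_state \<Rightarrow> bool" where
  "columns k \<sigma> \<longleftrightarrow> (\<forall>j\<le>k. narr \<sigma> ''reach'' j = narr \<sigma> ''edge'' (j * N + t) \<and>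
     rarr \<sigma> ''D'' j = rarr \<sigma> ''dist'' (j * N + t) \<and> rarr \<sigma> ''X'' j = real j)"

text \<open>The counters run one ahead: while level \<open>k\<close> is filled, \<open>''k''\<close>
  and \<open>''b''\<close> already refer to row \<open>Suc k\<close>, whose column entry is recorded
  only afterwards.\<close>

definition rows :: "nat \<Rightarrow> (nat \<times> nat \<times> nat) set \<Rightarrow> ram_state \<Rightarrow> bool" where
  "rows k F \<sigma> \<longleftrightarrow> input \<sigma> \<and> columns k \<sigma> \<and>
     table N s (steps M) c F (narr \<sigma> ''edge'') (narr \<sigma> ''prev'') (rarr \<sigma> ''dist'') k \<and>
     nvar \<sigma> ''k'' = Suc k \<and> nvar \<sigma> ''a'' = k * N \<and> nvar \<sigma> ''b'' = Suc k * N \<and> rvar \<sigma> ''x'' = real (Suc k)"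

lemma rows_relax:
  assumes F: "\<And>u e v. (u, e, v) \<in> F \<Longrightarrow> u < N \<and> v < N" and "u < N" "v < N"
  shows "triple (\<lambda>\<sigma>. rows k F \<sigma> \<and> nvar \<sigma> ''e'' = e \<and> narr \<sigma> X e = u \<and> narr \<sigma> Y e = v)
    (relax X Y) 100 (\<lambda>\<sigma>. rows k (insert (u, e, v) F) \<sigma> \<and> nvar \<sigma> ''e'' = e)"
proof (rule triple_run)
  show "loop_free (relax X Y)" "max_cost (relax X Y) \<le> 100"
    by (simp_all add: relax_def)
  fix \<sigma>
  assume pre: "rows k F \<sigma> \<and> nvar \<sigma> ''e'' = e \<and> narr \<sigma> X e = u \<and> narr \<sigma> Y e = v"
  let ?ed = "narr \<sigma> ''edge''" and ?pr = "narr \<sigma> ''prev''" and ?ds = "rarr \<sigma> ''dist''"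
  define p where "p = k * N + u"
  define q where "q = Suc k * N + v"
  have tab: "table N s (steps M) c F ?ed ?pr ?ds k"
    using pre by (simp add: rows_def)
  \<comment> \<open>The recorded entries come from rows up to \<open>k\<close>, so the write to
    \<open>q\<close> cannot invalidate them.\<close>
  have other: "j * N + t \<noteq> q" if "j \<le> k" for j
    using row_less[OF t that] by (simp add: q_def)
  show "rows k (insert (u, e, v) F) (run (relax X Y) \<sigma>) \<and> nvar (run (relax X Y) \<sigma>) ''e'' = e"
  proof (cases "0 < ?ed p \<and> \<not> (0 < ?ed q \<and> \<not> ?ds p + c e < ?ds q)")
    case True
    have "table N s (steps M) c (insert (u, e, v) F) (?ed(q := Suc e)) (?pr(q := u)) (?ds(q := ?ds p + c e)) k"
      unfolding p_def
      by (rule table_relax_update[OF tab]) (use assms s True steps_less in \<open>auto simp: p_def q_def\<close>)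
    then show ?thesis
      using pre True other by (simp add: relax_def rows_def input_def columns_def p_def q_def)
  next
    case False
    have "table N s (steps M) c (insert (u, e, v) F) ?ed ?pr ?ds k"
      by (rule table_relax_skip[OF tab]) (use False in \<open>auto simp: p_def q_def\<close>)
    then show ?thesis
      using pre False other by (auto simp: relax_def rows_def input_def columns_def p_def q_def)
  qed
qed

lemma rows_scan_edges:
  "triple (\<lambda>\<sigma>. rows k {} \<sigma> \<and> nvar \<sigma> ''e'' = 0) (scan_edges kind) (Suc M * 300) (rows k (steps M))"
proof -
  define I where "I m \<sigma> \<longleftrightarrow> rows k (steps m) \<sigma> \<and> nvar \<sigma> ''e'' = m" for m \<sigma>
  have body: "triple (I m) (Seq (relax ''tail'' ''head'') (Seq (relax (second_tail kind) (second_head kind))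
       (NAssign ''e'' (NAdd (NVar ''e'') (NConst 1))))) (100 + (100 + 4)) (I (Suc m))" if "m < M" for m
  proof (intro triple_Seq)
    let ?F = "insert (tl m, m, hd m) (steps m)"
    define u v where "u = (if kind = Directed then tl m else hd m)"
      and "v = (if kind = Directed then hd m else tl m)"
    have F: "u < N \<and> v < N" if "(u, e, v) \<in> steps m" for u e v
      using steps_less[OF that] \<open>m < M\<close> by simp
    have F': "u < N \<and> v < N" if "(u, e, v) \<in> ?F" for u e v
      using that F ends[OF \<open>m < M\<close>] by auto
    have less: "tl m < N" "hd m < N" "u < N" "v < N"
      using ends[OF \<open>m < M\<close>] by (auto simp: u_def v_def)
    show "triple (I m) (relax ''tail'' ''head'') 100 (\<lambda>\<sigma>. rows k ?F \<sigma> \<and> nvar \<sigma> ''e'' = m)"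
      by (rule triple_weaken[OF rows_relax[where k = k and e = m, OF F less(1,2)]])
        (auto simp: I_def rows_def input_def)
    have "narr \<sigma> (second_tail kind) m = u \<and> narr \<sigma> (second_head kind) m = v" if "rows k ?F \<sigma>" for \<sigma>
      using that unfolding rows_def input_def by (cases kind) (simp_all add: u_def v_def)
    then show "triple (\<lambda>\<sigma>. rows k ?F \<sigma> \<and> nvar \<sigma> ''e'' = m) (relax (second_tail kind) (second_head kind)) 100
      (\<lambda>\<sigma>. rows k (insert (u, m, v) ?F) \<sigma> \<and> nvar \<sigma> ''e'' = m)"
      by (intro triple_weaken[OF rows_relax[where k = k and e = m, OF F' less(3,4)]]) simp_all
    have "steps (Suc m) = insert (u, m, v) ?F"
      unfolding steps_Suc u_def v_def by simp
    then show "triple (\<lambda>\<sigma>. rows k (insert (u, m, v) ?F) \<sigma> \<and> nvar \<sigma> ''e'' = m)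
      (NAssign ''e'' (NAdd (NVar ''e'') (NConst 1))) 4 (I (Suc m))"
      by (intro triple_run) (auto simp: I_def rows_def input_def columns_def)
  qed
  have "triple (I 0) (scan_edges kind) (Suc M * (1 + bcost (NLess (NVar ''e'') (NVar ''M'')) + (100 + (100 + 4)))) (I M)"
    unfolding scan_edges_def by (rule triple_For[where I = I, OF body]) (auto simp: I_def rows_def input_def)
  then show ?thesis
    by (rule triple_weaken) (auto simp: I_def steps_def)
qed

text \<open>The final assertion says that rows \<open>0\<close> to \<open>N - 1\<close> are complete
  and that row \<open>N\<close> is empty, which covers the lengths of all paths.\<close>

lemma rows_fill_table:
  assumes "1 < N"
  shows "triple (\<lambda>\<sigma>. input \<sigma> \<and> narr \<sigma> ''edge'' = (\<lambda>_. 0) \<and> rarr \<sigma> ''dist'' = (\<lambda>_. 0) \<and>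
      nvar \<sigma> ''k'' = 0 \<and> nvar \<sigma> ''a'' = 0 \<and> nvar \<sigma> ''b'' = 0 \<and> rvar \<sigma> ''x'' = 0)
    (fill_table kind) (100 + Suc N * (Suc M * 500)) (rows (N - 1) {})"
  unfolding fill_table_def
proof (rule triple_Seq)
  define I where "I k = rows k {}" for k
  show "triple (\<lambda>\<sigma>. input \<sigma> \<and> narr \<sigma> ''edge'' = (\<lambda>_. 0) \<and> rarr \<sigma> ''dist'' = (\<lambda>_. 0) \<and>
      nvar \<sigma> ''k'' = 0 \<and> nvar \<sigma> ''a'' = 0 \<and> nvar \<sigma> ''b'' = 0 \<and> rvar \<sigma> ''x'' = 0)
    (seqs
       [NStore ''edge'' (NVar ''s'') (NConst 1),
        record_column,
        NAssign ''k'' (NConst 1),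
        NAssign ''b'' (NVar ''N''),
        RAssign ''x'' (RConst 1)]) 100 (I 0)"
    by (rule triple_run)
      (use s in \<open>auto simp: I_def record_column_def rows_def input_def columns_def table_def level_def\<close>)
  let ?post = "seqs
           [record_column,
            NAssign ''k'' (NAdd (NVar ''k'') (NConst 1)),
            NAssign ''a'' (NVar ''b''),
            NAssign ''b'' (NAdd (NVar ''b'') (NVar ''N'')),
            RAssign ''x'' (RAdd (RVar ''x'') (RConst 1))]"
  have body: "triple (I k) (Seq (NAssign ''e'' (NConst 0)) (Seq (scan_edges kind) ?post))
     (2 + (Suc M * 300 + 100)) (I (Suc k))" for k
  proof (intro triple_Seq)
    show "triple (I k) (NAssign ''e'' (NConst 0)) 2 (\<lambda>\<sigma>. rows k {} \<sigma> \<and> nvar \<sigma> ''e'' = 0)"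
      by (rule triple_run) (auto simp: I_def rows_def input_def columns_def)
    show "triple (\<lambda>\<sigma>. rows k {} \<sigma> \<and> nvar \<sigma> ''e'' = 0) (scan_edges kind) (Suc M * 300) (rows k (steps M))"
      by (rule rows_scan_edges)
    show "triple (rows k (steps M)) ?post 100 (I (Suc k))"
    proof (rule triple_run)
      fix \<sigma>
      assume pre: "rows k (steps M) \<sigma>"
      have "table N s (steps M) c {} (narr \<sigma> ''edge'') (narr \<sigma> ''prev'') (rarr \<sigma> ''dist'') (Suc k)"
        using pre assms by (intro table_next_row) (auto simp: rows_def)
      then show "I (Suc k) (run ?post \<sigma>)"
        using pre by (auto simp: I_def record_column_def rows_def input_def columns_def le_Suc_eq)
    qed (simp_all add: record_column_def)
  qed
  have "triple (I 0) (While (NLess (NVar ''k'') (NVar ''N'')) (Seq (NAssign ''e'' (NConst 0)) (Seq (scan_edges kind) ?post)))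
    (Suc (N - 1) * (1 + bcost (NLess (NVar ''k'') (NVar ''N'')) + (2 + (Suc M * 300 + 100)))) (I (N - 1))"
    by (rule triple_For[where I = I, OF body]) (use assms in \<open>auto simp: I_def rows_def input_def\<close>)
  then show "triple (I 0) (While (NLess (NVar ''k'') (NVar ''N'')) (Seq (NAssign ''e'' (NConst 0)) (Seq (scan_edges kind) ?post)))
    (Suc N * (Suc M * 500)) (rows (N - 1) {})"
  proof (rule triple_weaken)
    show "Suc (N - 1) * (1 + bcost (NLess (NVar ''k'') (NVar ''N'')) + (2 + (Suc M * 300 + 100))) \<le> Suc N * (Suc M * 500)"
      by (rule mult_le_mono) auto
  qed (auto simp: I_def)
qed

end

section \<open>Selecting and writing the paths\<close>

text \<open>A path under construction is written from position \<open>p\<close> on, behind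
  everything that is already part of the output.\<close>

lemma output_list_cong:
  assumes "nvar \<tau> ''size'' = nvar \<sigma> ''size''"
    and "\<And>i. i \<le> nvar \<sigma> ''size'' \<Longrightarrow> narr \<tau> ''start'' i = narr \<sigma> ''start'' i \<and> narr \<sigma> ''start'' i \<le> p"
    and "\<And>x. x < p \<Longrightarrow> narr \<tau> ''path'' x = narr \<sigma> ''path'' x"
  shows "output_list \<tau> = output_list \<sigma>"
  unfolding output_list_def assms(1)
proof (rule map_cong[OF refl])
  fix i
  assume "i \<in> set [0..<nvar \<sigma> ''size'']"
  then have "i < nvar \<sigma> ''size''"
    by simp
  then show "map (narr \<tau> ''path'') [narr \<tau> ''start'' i..<narr \<tau> ''start'' (Suc i)] =
      map (narr \<sigma> ''path'') [narr \<sigma> ''start'' i..<narr \<sigma> ''start'' (Suc i)]"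
    using assms(2)[of i] assms(2)[of "Suc i"] assms(3) by auto
qed

lemma output_list_snoc:
  assumes "nvar \<tau> ''size'' = Suc (nvar \<sigma> ''size'')"
    and "\<And>i. i \<le> nvar \<sigma> ''size'' \<Longrightarrow> narr \<tau> ''start'' i = narr \<sigma> ''start'' i"
    and "narr \<tau> ''path'' = narr \<sigma> ''path''"
  shows "output_list \<tau> = output_list \<sigma> @
    [map (narr \<sigma> ''path'') [narr \<sigma> ''start'' (nvar \<sigma> ''size'') ..< narr \<tau> ''start'' (Suc (nvar \<sigma> ''size''))]]"
  unfolding output_list_def assms(1) using assms(2,3) by auto

text \<open>The quotient is the \<open>lam\<close> at which lines \<open>k\<close> and
  \<open>j\<close> cross; \<open>''lo''\<close> ends as the maximum of \<open>0\<close> and these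
  values over all reachable \<open>j > k\<close>.\<close>

definition find_slope :: com where
  "find_slope = While (NLess (NVar ''j'') (NVar ''N''))
     (seqs
       [RAssign ''d'' (RDiv (RSub (RArr ''D'' (NVar ''k'')) (RArr ''D'' (NVar ''j'')))
          (RSub (RArr ''X'' (NVar ''j'')) (RArr ''X'' (NVar ''k'')))),
        If (Conj (NLess (NConst 0) (NArr ''reach'' (NVar ''j''))) (RLess (RVar ''lo'') (RVar ''d'')))
          (RAssign ''lo'' (RVar ''d'')) Skip,
        NAssign ''j'' (NAdd (NVar ''j'') (NConst 1))])"

text \<open>The vertex meant here is one of the lower convex hull of the points
  \<open>(k, D k)\<close>, dual to a line on the envelope, not a vertex of the graph.\<close>

definition test_vertex :: com where
  "test_vertex = While (NLess (NVar ''j'') (NVar ''k''))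
     (seqs
       [If (Conj (NLess (NConst 0) (NArr ''reach'' (NVar ''j'')))
            (Neg (RLess (RAdd (RArr ''D'' (NVar ''k'')) (RMul (RVar ''lo'') (RArr ''X'' (NVar ''k''))))
                        (RAdd (RArr ''D'' (NVar ''j'')) (RMul (RVar ''lo'') (RArr ''X'' (NVar ''j'')))))))
          (NAssign ''ok'' (NConst 0)) Skip,
        NAssign ''j'' (NAdd (NVar ''j'') (NConst 1))])"

text \<open>Predecessors yield the path from its end, so its cells are filled downwards and
  \<open>''pos''\<close> itself comes last.\<close>

definition write_path :: com where
  "write_path = While (NLess (NConst 0) (NVar ''i''))
     (seqs
       [NAssign ''p'' (NAdd (NVar ''a'') (NVar ''v'')),
        NAssign ''i'' (NSub (NVar ''i'') (NConst 1)),
        NStore ''path'' (NAdd (NVar ''pos'') (NVar ''i'')) (NSub (NArr ''edge'' (NVar ''p'')) (NConst 1)),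
        NAssign ''v'' (NArr ''prev'' (NVar ''p'')),
        NAssign ''a'' (NSub (NVar ''a'') (NVar ''N''))])"

text \<open>For a rejected \<open>k\<close> the counter \<open>''i''\<close> starts at
  \<open>0\<close>, so \<open>write_path\<close> does nothing. This keeps the body a plain sequence
  of loops and loop-free pieces.\<close>

definition write_solution :: com where
  "write_solution = Seq
     (seqs
       [NAssign ''size'' (NConst 0), NAssign ''pos'' (NConst 0), NStore ''start'' (NConst 0) (NConst 0),
        NAssign ''k'' (NConst 0), NAssign ''b'' (NConst 0)])
     (While (NLess (NVar ''k'') (NVar ''N''))
       (Seq (seqs [RAssign ''lo'' (RConst 0), NAssign ''j'' (NAdd (NVar ''k'') (NConst 1))])
       (Seq find_slope
       (Seq (seqs [NAssign ''ok'' (NArr ''reach'' (NVar ''k'')), NAssign ''j'' (NConst 0)])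
       (Seq test_vertex
       (Seq
         (seqs
           [If (NLess (NConst 0) (NVar ''ok'')) (NAssign ''i'' (NVar ''k'')) (NAssign ''i'' (NConst 0)),
            NAssign ''v'' (NVar ''t''), NAssign ''a'' (NVar ''b'')])
       (Seq write_path
         (seqs
           [If (NLess (NConst 0) (NVar ''ok''))
              (seqs
                [NAssign ''pos'' (NAdd (NVar ''pos'') (NVar ''k'')),
                 NAssign ''size'' (NAdd (NVar ''size'') (NConst 1)),
                 NStore ''start'' (NVar ''size'') (NVar ''pos'')])
              Skip,
            NAssign ''k'' (NAdd (NVar ''k'') (NConst 1)),
            NAssign ''b'' (NAdd (NVar ''b'') (NVar ''N''))]))))))))"

section \<open>Correctness of selecting and writing the paths\<close>

locale program_table =
  fixes N t :: nat and ed pr R :: "nat \<Rightarrow> nat" and D :: "nat \<Rightarrow> real"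
begin

definition candidates :: "nat set" where
  "candidates = {j. j < N \<and> 0 < R j}"

abbreviation walk :: "nat \<Rightarrow> nat \<Rightarrow> nat list" where
  "walk \<equiv> backtrack (\<lambda>i v. ed (i * N + v) - 1) (\<lambda>i v. pr (i * N + v))"

definition chosen :: "nat \<Rightarrow> nat list" where
  "chosen k = filter (\<lambda>j. j \<in> envelope candidates D) [0..<k]"

definition frame :: "ram_state \<Rightarrow> bool" where
  "frame \<sigma> \<longleftrightarrow> nvar \<sigma> ''N'' = N \<and> nvar \<sigma> ''t'' = t \<and> narr \<sigma> ''edge'' = ed \<and> narr \<sigma> ''prev'' = pr \<and>
     narr \<sigma> ''reach'' = R \<and> rarr \<sigma> ''D'' = D \<and> (\<forall>j<N. rarr \<sigma> ''X'' j = real j)"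

definition written :: "nat \<Rightarrow> ram_state \<Rightarrow> bool" where
  "written k \<sigma> \<longleftrightarrow> frame \<sigma> \<and> nvar \<sigma> ''k'' = k \<and> nvar \<sigma> ''b'' = k * N \<and>
     output_list \<sigma> = map (\<lambda>j. walk j t) (chosen k) \<and>
     narr \<sigma> ''start'' (nvar \<sigma> ''size'') = nvar \<sigma> ''pos'' \<and>
     (\<forall>i\<le>nvar \<sigma> ''size''. narr \<sigma> ''start'' i \<le> nvar \<sigma> ''pos'')"

lemmas written_defs = written_def frame_def output_list_def

text \<open>The invariant of \<open>find_slope\<close>. Only lines between \<open>k\<close> and
  \<open>j\<close> have been compared, but minimality of \<open>l\<close> refers to those
  \<open>lam\<close> that respect every larger line, so \<open>j = N\<close> gives the hypotheses of
  \<open>envelope_iff\<close>.\<close>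

definition slope :: "nat \<Rightarrow> nat \<Rightarrow> real \<Rightarrow> bool" where
  "slope k j l \<longleftrightarrow> 0 \<le> l \<and>
     (\<forall>j'\<in>candidates. k < j' \<longrightarrow> j' < j \<longrightarrow> D k + l * real k \<le> D j' + l * real j') \<and>
     (\<forall>lam::real. 0 \<le> lam \<longrightarrow> (\<forall>j'\<in>candidates. k < j' \<longrightarrow> D k + lam * real k \<le> D j' + lam * real j') \<longrightarrow> l \<le> lam)"

lemma slope_init: "slope k (Suc k) 0"
  by (simp add: slope_def)

text \<open>Line \<open>k\<close> is not above line \<open>j\<close> exactly from the crossing point
  \<open>d\<close> on. Raising \<open>l\<close> to \<open>d\<close> preserves earlier comparisons,
  as lines with larger index rise faster, and every admissible \<open>lam\<close> is at least
  \<open>d\<close>.\<close>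

lemma slope_Suc:
  assumes "slope k j l" "k < j" "j < N" and d: "d = (D k - D j) / (real j - real k)"
  shows "slope k (Suc j) (if 0 < R j \<and> l < d then d else l)"
proof -
  have d_le: "D k + lam * k \<le> D j + lam * j \<longleftrightarrow> d \<le> lam" for lam :: real
  proof -
    have "0 < real j - real k"
      using assms(2) by simp
    then show ?thesis
      unfolding d by (simp add: pos_divide_le_eq algebra_simps)
  qed
  note l = assms(1)[unfolded slope_def]
  note nonneg = l[THEN conjunct1] and above = l[THEN conjunct2, THEN conjunct1]
    and least = l[THEN conjunct2, THEN conjunct2]
  show ?thesis
  proof (cases "0 < R j \<and> l < d")
    case True
    then have j: "j \<in> candidates"
      using assms(3) by (simp add: candidates_def)
    have "D k + d * k \<le> D i + d * i" if "i \<in> candidates" "k < i" "i < Suc j" for i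
    proof (cases "i = j")
      case False
      then have "D k + l * k \<le> D i + l * i"
        using above that by simp
      moreover have "0 \<le> (d - l) * (real i - real k)"
        using True that(2) by simp
      ultimately show ?thesis
        by (simp add: algebra_simps)
    qed (use d_le[of d] in simp)
    moreover have "d \<le> lam" if "\<forall>j'\<in>candidates. k < j' \<longrightarrow> D k + lam * k \<le> D j' + lam * j'" for lam :: real
      using that j assms(2) d_le by blast
    moreover have "0 \<le> d"
      using True nonneg by simp
    ultimately have "slope k (Suc j) d"
      unfolding slope_def by simp
    then show ?thesis
      using True by simp
  next
    case False
    then have "j \<in> candidates \<Longrightarrow> D k + l * k \<le> D j + l * j"
      unfolding d_le by (auto simp: candidates_def)
    then have "D k + l * k \<le> D i + l * i" if "i \<in> candidates" "k < i" "i < Suc j" for i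
      using that above by (cases "i = j") auto
    then have "slope k (Suc j) l"
      using nonneg least unfolding slope_def by simp
    then show ?thesis
      using False by auto
  qed
qed

lemma written_find_slope:
  assumes "k < N"
  shows "triple (\<lambda>\<sigma>. written k \<sigma> \<and> nvar \<sigma> ''j'' = Suc k \<and> rvar \<sigma> ''lo'' = 0) find_slope (Suc N * 100)
    (\<lambda>\<sigma>. written k \<sigma> \<and> slope k N (rvar \<sigma> ''lo''))"
proof -
  define I where "I j \<sigma> \<longleftrightarrow> written k \<sigma> \<and> nvar \<sigma> ''j'' = j \<and> k < j \<and> slope k j (rvar \<sigma> ''lo'')" for j \<sigma>
  let ?body = "seqs
       [RAssign ''d'' (RDiv (RSub (RArr ''D'' (NVar ''k'')) (RArr ''D'' (NVar ''j'')))
          (RSub (RArr ''X'' (NVar ''j'')) (RArr ''X'' (NVar ''k'')))),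
        If (Conj (NLess (NConst 0) (NArr ''reach'' (NVar ''j''))) (RLess (RVar ''lo'') (RVar ''d'')))
          (RAssign ''lo'' (RVar ''d'')) Skip,
        NAssign ''j'' (NAdd (NVar ''j'') (NConst 1))]"
  have body: "triple (I j) ?body 50 (I (Suc j))" if "j < N" for j
  proof (rule triple_run)
    fix \<sigma>
    assume I: "I j \<sigma>"
    then have "slope k (Suc j) (rvar (run ?body \<sigma>) ''lo'')"
      using slope_Suc[of k j "rvar \<sigma> ''lo''", OF _ _ _ refl] assms that
      by (auto simp: I_def written_def frame_def split: if_splits)
    then show "I (Suc j) (run ?body \<sigma>)"
      using I assms by (auto simp: I_def written_defs)
  qed simp_all
  have "triple (I (Suc k)) find_slope (Suc N * (1 + bcost (NLess (NVar ''j'') (NVar ''N'')) + 50)) (I N)"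
    unfolding find_slope_def
    by (rule triple_For[where I = I, OF body]) (use assms in \<open>auto simp: I_def written_defs\<close>)
  then show ?thesis
    by (rule triple_weaken) (auto simp: I_def slope_init)
qed

text \<open>Starting \<open>''ok''\<close> from \<open>R k\<close> rejects unreachable
  \<open>k\<close>; for the others \<open>envelope_iff\<close> reduces membership to the comparisons
  with smaller \<open>j\<close> at \<open>''lo''\<close>.\<close>

lemma written_test_vertex:
  assumes "k < N"
  shows "triple (\<lambda>\<sigma>. written k \<sigma> \<and> slope k N (rvar \<sigma> ''lo'') \<and> nvar \<sigma> ''ok'' = R k \<and> nvar \<sigma> ''j'' = 0)
    test_vertex (Suc N * 100)
    (\<lambda>\<sigma>. written k \<sigma> \<and> (0 < nvar \<sigma> ''ok'' \<longleftrightarrow> k \<in> envelope candidates D))"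
proof -
  define I where "I j \<sigma> \<longleftrightarrow> written k \<sigma> \<and> slope k N (rvar \<sigma> ''lo'') \<and> nvar \<sigma> ''j'' = j \<and>
      (0 < nvar \<sigma> ''ok'' \<longleftrightarrow> 0 < R k \<and>
        (\<forall>i<j. 0 < R i \<longrightarrow> D k + rvar \<sigma> ''lo'' * k < D i + rvar \<sigma> ''lo'' * i))" for j \<sigma>
  have body: "triple (I j) (seqs
       [If (Conj (NLess (NConst 0) (NArr ''reach'' (NVar ''j'')))
            (Neg (RLess (RAdd (RArr ''D'' (NVar ''k'')) (RMul (RVar ''lo'') (RArr ''X'' (NVar ''k''))))
                        (RAdd (RArr ''D'' (NVar ''j'')) (RMul (RVar ''lo'') (RArr ''X'' (NVar ''j'')))))))
          (NAssign ''ok'' (NConst 0)) Skip,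
        NAssign ''j'' (NAdd (NVar ''j'') (NConst 1))]) 50 (I (Suc j))" if "j < k" for j
    by (rule triple_run)
      (use assms that in \<open>auto simp: I_def written_defs less_Suc_eq\<close>)
  have "triple (I 0) test_vertex (Suc k * (1 + bcost (NLess (NVar ''j'') (NVar ''k'')) + 50)) (I k)"
    unfolding test_vertex_def
    by (rule triple_For[where I = I, OF body]) (use assms in \<open>auto simp: I_def written_defs\<close>)
  then show ?thesis
  proof (rule triple_weaken)
    show "Suc k * (1 + bcost (NLess (NVar ''j'') (NVar ''k'')) + 50) \<le> Suc N * 100"
      using assms by (intro mult_le_mono) auto
    fix \<sigma>
    assume I: "I k \<sigma>"
    let ?l = "rvar \<sigma> ''lo''"
    have l: "slope k N ?l"
      using I by (simp add: I_def)
    have "0 < nvar \<sigma> ''ok'' \<longleftrightarrow> k \<in> envelope candidates D"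
    proof (cases "0 < R k")
      case True
      then have "k \<in> candidates"
        using assms by (simp add: candidates_def)
      then have "k \<in> envelope candidates D \<longleftrightarrow> (\<forall>j\<in>candidates. j < k \<longrightarrow> D k + ?l * k < D j + ?l * j)"
        using l by (intro envelope_iff) (auto simp: slope_def candidates_def)
      also have "\<dots> \<longleftrightarrow> 0 < nvar \<sigma> ''ok''"
        using I True assms by (auto simp: I_def candidates_def)
      finally show ?thesis
        by simp
    next
      case False
      then show ?thesis
        using I by (auto simp: I_def envelope_def first_min_def candidates_def)
    qed
    then show "written k \<sigma> \<and> (0 < nvar \<sigma> ''ok'' \<longleftrightarrow> k \<in> envelope candidates D)"
      using I by (simp add: I_def)
  qed (auto simp: I_def)
qed

lemma written_write_path:
  assumes "k < N" and "kk = (if k \<in> envelope candidates D then k else 0)"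
  shows "triple (\<lambda>\<sigma>. written k \<sigma> \<and> (0 < nvar \<sigma> ''ok'' \<longleftrightarrow> k \<in> envelope candidates D) \<and>
      nvar \<sigma> ''i'' = kk \<and> nvar \<sigma> ''v'' = t \<and> nvar \<sigma> ''a'' = k * N)
    write_path (Suc N * 100)
    (\<lambda>\<sigma>. written k \<sigma> \<and> (0 < nvar \<sigma> ''ok'' \<longleftrightarrow> k \<in> envelope candidates D) \<and>
      walk kk t = map (narr \<sigma> ''path'') [nvar \<sigma> ''pos''..<nvar \<sigma> ''pos'' + kk])"
proof -
  \<comment> \<open>The walk splits into a part still to be traced back and a suffix already stored.
    The offset \<open>''a''\<close> is tied to the counter only while the loop runs, because for a
    rejected \<open>k\<close> it starts at \<open>k * N\<close> although
    \<open>kk = 0\<close>.\<close>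
  define I where "I m \<sigma> \<longleftrightarrow> written k \<sigma> \<and> (0 < nvar \<sigma> ''ok'' \<longleftrightarrow> k \<in> envelope candidates D) \<and>
      nvar \<sigma> ''i'' = kk - m \<and> (m < kk \<longrightarrow> nvar \<sigma> ''a'' = (kk - m) * N) \<and>
      walk kk t = walk (kk - m) (nvar \<sigma> ''v'') @
        map (narr \<sigma> ''path'') [nvar \<sigma> ''pos'' + (kk - m)..<nvar \<sigma> ''pos'' + kk]" for m \<sigma>
  let ?body = "seqs
       [NAssign ''p'' (NAdd (NVar ''a'') (NVar ''v'')),
        NAssign ''i'' (NSub (NVar ''i'') (NConst 1)),
        NStore ''path'' (NAdd (NVar ''pos'') (NVar ''i'')) (NSub (NArr ''edge'' (NVar ''p'')) (NConst 1)),
        NAssign ''v'' (NArr ''prev'' (NVar ''p'')),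
        NAssign ''a'' (NSub (NVar ''a'') (NVar ''N''))]"
  have body: "triple (I m) ?body 50 (I (Suc m))" if "m < kk" for m
  proof (rule triple_run)
    fix \<sigma>
    assume I: "I m \<sigma>"
    obtain r where r: "kk - m = Suc r" "kk - Suc m = r"
      using \<open>m < kk\<close> by (metis Suc_diff_Suc)
    have "output_list (run ?body \<sigma>) = output_list \<sigma>"
      by (rule output_list_cong[where p = "nvar \<sigma> ''pos''"])
        (use I in \<open>auto simp: I_def written_def\<close>)
    moreover have "[nvar \<sigma> ''pos'' + r..<nvar \<sigma> ''pos'' + kk] =
        (nvar \<sigma> ''pos'' + r) # [nvar \<sigma> ''pos'' + Suc r..<nvar \<sigma> ''pos'' + kk]"
      using r by (subst upt_conv_Cons) auto
    ultimately show "I (Suc m) (run ?body \<sigma>)"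
      using I \<open>m < kk\<close> unfolding I_def written_def r by (auto simp: frame_def)
  qed simp_all
  have "triple (I 0) write_path (Suc kk * (1 + bcost (NLess (NConst 0) (NVar ''i'')) + 50)) (I kk)"
    unfolding write_path_def
    by (rule triple_For[where I = I, OF body]) (auto simp: I_def)
  then show ?thesis
  proof (rule triple_weaken)
    show "Suc kk * (1 + bcost (NLess (NConst 0) (NVar ''i'')) + 50) \<le> Suc N * 100"
      using assms by (intro mult_le_mono) auto
  qed (auto simp: I_def assms(2) split: if_splits)
qed

text \<open>Each of the \<open>N\<close> rounds contains three loops of at most \<open>N\<close>
  rounds, whence the quadratic bound.\<close>

lemma written_write_solution:
  "triple frame write_solution (100 + Suc N * (Suc N * 500)) (\<lambda>\<sigma>. output_list \<sigma> = map (\<lambda>j. walk j t) (chosen N))"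
  unfolding write_solution_def
proof (rule triple_Seq)
  show "triple frame (seqs
       [NAssign ''size'' (NConst 0), NAssign ''pos'' (NConst 0), NStore ''start'' (NConst 0) (NConst 0),
        NAssign ''k'' (NConst 0), NAssign ''b'' (NConst 0)]) 100 (written 0)"
    by (rule triple_run) (auto simp: written_defs chosen_def)
  let ?pre = "seqs [RAssign ''lo'' (RConst 0), NAssign ''j'' (NAdd (NVar ''k'') (NConst 1))]"
  let ?pre2 = "seqs [NAssign ''ok'' (NArr ''reach'' (NVar ''k'')), NAssign ''j'' (NConst 0)]"
  let ?pre3 = "seqs
           [If (NLess (NConst 0) (NVar ''ok'')) (NAssign ''i'' (NVar ''k'')) (NAssign ''i'' (NConst 0)),
            NAssign ''v'' (NVar ''t''), NAssign ''a'' (NVar ''b'')]"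
  let ?post = "seqs
           [If (NLess (NConst 0) (NVar ''ok''))
              (seqs
                [NAssign ''pos'' (NAdd (NVar ''pos'') (NVar ''k'')),
                 NAssign ''size'' (NAdd (NVar ''size'') (NConst 1)),
                 NStore ''start'' (NVar ''size'') (NVar ''pos'')])
              Skip,
            NAssign ''k'' (NAdd (NVar ''k'') (NConst 1)),
            NAssign ''b'' (NAdd (NVar ''b'') (NVar ''N''))]"
  let ?body = "Seq ?pre (Seq find_slope (Seq ?pre2 (Seq test_vertex (Seq ?pre3 (Seq write_path ?post)))))"
  have body: "triple (written k) ?body
      (20 + (Suc N * 100 + (20 + (Suc N * 100 + (20 + (Suc N * 100 + 50)))))) (written (Suc k))" if "k < N" for k
  proof (intro triple_Seq)
    define kk where "kk = (if k \<in> envelope candidates D then k else 0)"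
    show "triple (written k) ?pre 20 (\<lambda>\<sigma>. written k \<sigma> \<and> nvar \<sigma> ''j'' = Suc k \<and> rvar \<sigma> ''lo'' = 0)"
      by (rule triple_run) (auto simp: written_defs)
    show "triple (\<lambda>\<sigma>. written k \<sigma> \<and> nvar \<sigma> ''j'' = Suc k \<and> rvar \<sigma> ''lo'' = 0) find_slope (Suc N * 100)
      (\<lambda>\<sigma>. written k \<sigma> \<and> slope k N (rvar \<sigma> ''lo''))"
      by (rule written_find_slope[OF \<open>k < N\<close>])
    show "triple (\<lambda>\<sigma>. written k \<sigma> \<and> slope k N (rvar \<sigma> ''lo'')) ?pre2 20
      (\<lambda>\<sigma>. written k \<sigma> \<and> slope k N (rvar \<sigma> ''lo'') \<and> nvar \<sigma> ''ok'' = R k \<and> nvar \<sigma> ''j'' = 0)"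
      by (rule triple_run) (auto simp: written_defs)
    show "triple (\<lambda>\<sigma>. written k \<sigma> \<and> slope k N (rvar \<sigma> ''lo'') \<and> nvar \<sigma> ''ok'' = R k \<and> nvar \<sigma> ''j'' = 0)
      test_vertex (Suc N * 100) (\<lambda>\<sigma>. written k \<sigma> \<and> (0 < nvar \<sigma> ''ok'' \<longleftrightarrow> k \<in> envelope candidates D))"
      by (rule written_test_vertex[OF \<open>k < N\<close>])
    show "triple (\<lambda>\<sigma>. written k \<sigma> \<and> (0 < nvar \<sigma> ''ok'' \<longleftrightarrow> k \<in> envelope candidates D)) ?pre3 20
      (\<lambda>\<sigma>. written k \<sigma> \<and> (0 < nvar \<sigma> ''ok'' \<longleftrightarrow> k \<in> envelope candidates D) \<and>
        nvar \<sigma> ''i'' = kk \<and> nvar \<sigma> ''v'' = t \<and> nvar \<sigma> ''a'' = k * N)"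
      by (rule triple_run) (auto simp: written_defs kk_def)
    show "triple (\<lambda>\<sigma>. written k \<sigma> \<and> (0 < nvar \<sigma> ''ok'' \<longleftrightarrow> k \<in> envelope candidates D) \<and>
        nvar \<sigma> ''i'' = kk \<and> nvar \<sigma> ''v'' = t \<and> nvar \<sigma> ''a'' = k * N)
      write_path (Suc N * 100)
      (\<lambda>\<sigma>. written k \<sigma> \<and> (0 < nvar \<sigma> ''ok'' \<longleftrightarrow> k \<in> envelope candidates D) \<and>
        walk kk t = map (narr \<sigma> ''path'') [nvar \<sigma> ''pos''..<nvar \<sigma> ''pos'' + kk])"
      by (rule written_write_path[OF \<open>k < N\<close> kk_def])
    show "triple (\<lambda>\<sigma>. written k \<sigma> \<and> (0 < nvar \<sigma> ''ok'' \<longleftrightarrow> k \<in> envelope candidates D) \<and>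
        walk kk t = map (narr \<sigma> ''path'') [nvar \<sigma> ''pos''..<nvar \<sigma> ''pos'' + kk]) ?post 50 (written (Suc k))"
    proof (rule triple_run)
      fix \<sigma>
      assume pre: "written k \<sigma> \<and> (0 < nvar \<sigma> ''ok'' \<longleftrightarrow> k \<in> envelope candidates D) \<and>
        walk kk t = map (narr \<sigma> ''path'') [nvar \<sigma> ''pos''..<nvar \<sigma> ''pos'' + kk]"
      show "written (Suc k) (run ?post \<sigma>)"
      proof (cases "k \<in> envelope candidates D")
        case True
        have "output_list (run ?post \<sigma>) = output_list \<sigma> @ [map (narr \<sigma> ''path'')
            [narr \<sigma> ''start'' (nvar \<sigma> ''size'') ..< narr (run ?post \<sigma>) ''start'' (Suc (nvar \<sigma> ''size''))]]"
          by (rule output_list_snoc) (use True pre in auto)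
        also have "\<dots> = output_list \<sigma> @ [walk k t]"
          using True pre by (simp add: written_def kk_def)
        finally show ?thesis
          using True pre by (auto simp: written_def frame_def chosen_def le_Suc_eq)
      next
        case False
        have "output_list (run ?post \<sigma>) = output_list \<sigma>"
          using False pre by (simp add: output_list_def)
        then show ?thesis
          using False pre by (auto simp: written_def frame_def chosen_def)
      qed
    qed simp_all
  qed
  have "triple (written 0) (While (NLess (NVar ''k'') (NVar ''N'')) ?body)
    (Suc N * (1 + bcost (NLess (NVar ''k'') (NVar ''N'')) +
      (20 + (Suc N * 100 + (20 + (Suc N * 100 + (20 + (Suc N * 100 + 50)))))))) (written N)"
    by (rule triple_For[where I = written, OF body]) (auto simp: written_defs)
  then show "triple (written 0) (While (NLess (NVar ''k'') (NVar ''N'')) ?body)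
    (Suc N * (Suc N * 500)) (\<lambda>\<sigma>. output_list \<sigma> = map (\<lambda>j. walk j t) (chosen N))"
  proof (rule triple_weaken)
    show "Suc N * (1 + bcost (NLess (NVar ''k'') (NVar ''N'')) +
      (20 + (Suc N * 100 + (20 + (Suc N * 100 + (20 + (Suc N * 100 + 50))))))) \<le> Suc N * (Suc N * 500)"
      by (rule mult_le_mono2) simp
  qed (auto simp: written_def)
qed

end

section \<open>Solving the problem\<close>

text \<open>The common meaning of the triples in \<open>steps\<close>, which the program relaxes,
  and of \<open>step\<close> in the labelled digraph.\<close>

definition graph_step :: "graph_kind \<Rightarrow> ('v, 'e) pre_digraph \<Rightarrow> 'v \<Rightarrow> 'e \<Rightarrow> 'v \<Rightarrow> bool" where
  "graph_step kind G u e v \<longleftrightarrow> e \<in> arcs G \<and>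
     (tail G e = u \<and> head G e = v \<or> kind = Undirected \<and> head G e = u \<and> tail G e = v)"

lemma labelled_digraph_directed:
  assumes "fin_digraph G"
  shows "labelled_digraph G id"
proof -
  interpret fin_digraph G by fact
  show ?thesis by unfold_locales auto
qed

lemma labelled_digraph_undirected:
  assumes "fin_digraph G"
  shows "labelled_digraph (bidirect G) fst"
proof -
  interpret fin_digraph G by fact
  show ?thesis by unfold_locales (auto simp: bidirect_def split: if_splits)
qed

text \<open>Transfers \<open>solution_optimal\<close> to the given graph: the walk table lives on
  \<open>G\<close> itself or on \<open>bidirect G\<close>, whose labels are again the edges of
  \<open>G\<close>.\<close>

lemma table_solution:
  fixes dist :: "nat \<Rightarrow> nat \<Rightarrow> real"
  assumes inst: "sp_instance kind N M G s t c"
    and "\<And>v. v < N \<Longrightarrow> reach 0 v \<longleftrightarrow> v = s" "dist 0 s = 0"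
    and "\<And>i v. Suc i < N \<Longrightarrow> v < N \<Longrightarrow> reach (Suc i) v \<Longrightarrow>
      graph_step kind G (prv (Suc i) v) (edge (Suc i) v) v \<and> reach i (prv (Suc i) v) \<and>
      dist (Suc i) v = dist i (prv (Suc i) v) + c (edge (Suc i) v)"
    and "\<And>i u e v. Suc i < N \<Longrightarrow> graph_step kind G u e v \<Longrightarrow> reach i u \<Longrightarrow>
      reach (Suc i) v \<and> dist (Suc i) v \<le> dist i u + c e"
    and S: "S = (\<lambda>k. backtrack edge prv k t) ` envelope {k. k < N \<and> reach k t} (\<lambda>k. dist k t)"
  shows "variable_sized_solution (st_paths kind G s t) c (unit_box (arcs G)) S" "card S \<le> N"
proof -
  have G: "fin_digraph G" "verts G = {..<N}" "s < N" "t < N" "t \<noteq> s"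
    "st_paths kind G s t \<noteq> {}" "\<And>e. e \<in> arcs G \<Longrightarrow> 0 \<le> c e"
    using inst by (auto simp: sp_instance_def)
  have "variable_sized_solution (st_paths kind G s t) c (unit_box (arcs G)) S \<and> card S \<le> N"
  proof (cases kind)
    case Directed
    interpret labelled_digraph G id
      using G(1) by (rule labelled_digraph_directed)
    have step: "step = graph_step kind G"
      unfolding fun_eq_iff step_def graph_step_def using Directed by auto
    interpret walk_table G id s t c N reach dist edge prv
      using assms(2-5) G unfolding step[symmetric]
      by unfold_locales (auto simp: Directed)
    show ?thesis
      using solution_optimal by (simp add: Directed solution_def lengths_def paths_def S)
  next
    case Undirected
    interpret labelled_digraph "bidirect G" fst
      using G(1) by (rule labelled_digraph_undirected)
    have step: "step = graph_step kind G"
      unfolding fun_eq_iff step_def graph_step_def using Undirected by (auto simp: bidirect_def split: if_splits)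
    have "verts (bidirect G) = verts G" "fst ` arcs (bidirect G) = arcs G"
      by (simp_all add: bidirect_def)
    interpret walk_table "bidirect G" fst s t c N reach dist edge prv
      using assms(2-5) G unfolding step[symmetric]
      by unfold_locales (auto simp: Undirected bidirect_def)
    show ?thesis
      using solution_optimal \<open>fst ` arcs (bidirect G) = arcs G\<close>
      by (simp add: Undirected solution_def lengths_def paths_def S)
  qed
  then show "variable_sized_solution (st_paths kind G s t) c (unit_box (arcs G)) S" "card S \<le> N"
    by blast+
qed

text \<open>The target has no additive constant. Since \<open>N \<ge> 2\<close>, lower-order terms
  are absorbed by \<open>N * N\<close>, and \<open>ln N \<ge> 1 / 2\<close> absorbs the quadratic
  term.\<close>

lemma time_bound:
  fixes N M :: nat
  assumes "2 \<le> N" "T \<le> 100 + Suc N * (Suc M * 500) + (100 + Suc N * (Suc N * 500))"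
  shows "real T \<le> 10000 * (real N * real M + (real N)\<^sup>2 * ln (real N))"
proof -
  have "Suc N * (Suc M * 500) \<le> (2 * N) * (Suc M * 500)"
    using assms(1) by (intro mult_le_mono1) simp
  also have "\<dots> = 1000 * (N * M) + 1000 * N"
    by (simp add: algebra_simps)
  finally have 1: "Suc N * (Suc M * 500) \<le> 1000 * (N * M) + 1000 * N" .
  have "Suc N * (Suc N * 500) \<le> (2 * N) * ((2 * N) * 500)"
    using assms(1) by (intro mult_le_mono) auto
  then have 2: "Suc N * (Suc N * 500) \<le> 2000 * (N * N)"
    by simp
  have 3: "2 * N \<le> N * N" "4 \<le> N * N"
    using assms(1) mult_le_mono[of 2 N 2 N] by auto
  have "T \<le> 1000 * (N * M) + 3000 * (N * N)"
    using assms(2) 1 2 3 by linarith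
  then have "real T \<le> real (1000 * (N * M) + 3000 * (N * N))"
    by (rule of_nat_mono)
  then have T: "real T \<le> 1000 * (real N * real M) + 3000 * (real N)\<^sup>2"
    by (simp add: power2_eq_square)
  have "1 / 2 \<le> ln (2 :: real)"
    using ln_le_minus_one[of "1 / 2 :: real"] by (simp add: ln_div)
  also have "\<dots> \<le> ln (real N)"
    using assms(1) by simp
  finally have "(real N)\<^sup>2 * (1 / 2) \<le> (real N)\<^sup>2 * ln (real N)"
    by (intro mult_left_mono) auto
  then have "3000 * (real N)\<^sup>2 \<le> 10000 * ((real N)\<^sup>2 * ln (real N))"
    using zero_le_power2[of "real N"] by linarith
  moreover have "1000 * (real N * real M) \<le> 10000 * (real N * real M)"
    by simp
  ultimately show ?thesis
    using T unfolding distrib_left by linarith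
qed

theorem theorem6:
  fixes kind :: graph_kind
  shows "\<exists>(prog :: com) (C :: real).
    \<forall>(N :: nat) (M :: nat) (G :: (nat, nat) pre_digraph) (s :: nat) (t :: nat) (c_hat :: nat \<Rightarrow> real).
      sp_instance kind N M G s t c_hat \<longrightarrow>
      (\<exists>(T :: nat) (\<tau> :: ram_state) (S :: nat list set).
         exec prog (input_state N M G s t c_hat) T \<tau> \<and>
         real T \<le> C * (real N * real M + (real N)\<^sup>2 * ln (real N)) \<and>
         outputs_set \<tau> S \<and>
         variable_sized_solution (st_paths kind G s t) c_hat (unit_box (arcs G)) S \<and>
         card S \<le> N)"
proof (intro exI[of _ "Seq (fill_table kind) write_solution"] exI[of _ "10000 :: real"] allI impI)
  fix N M :: nat and G :: "(nat, nat) pre_digraph" and s t :: nat and c_hat :: "nat \<Rightarrow> real"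
  assume inst: "sp_instance kind N M G s t c_hat"
  then have G: "fin_digraph G" "verts G = {..<N}" "arcs G = {..<M}" "s < N" "t < N" "t \<noteq> s"
    by (auto simp: sp_instance_def)
  then have N: "2 \<le> N"
    by linarith
  \<comment> \<open>The input arrays hold \<open>0\<close> beyond the last edge. Only below
    \<open>M\<close> do they agree with the data of the instance, so edges met later must be shown
    to lie there.\<close>
  define tl where "tl e = (if e < M then tail G e else 0)" for e
  define hd where "hd e = (if e < M then head G e else 0)" for e
  define c where "c e = (if e < M then c_hat e else 0)" for e
  interpret G: fin_digraph G by fact
  interpret program_input kind N M s t tl hd c
  proof
    show "tl e < N \<and> hd e < N" if "e < M" for e
      using that G.tail_in_verts[of e] G.head_in_verts[of e] G(2,3) by (simp add: tl_def hd_def)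
  qed (use G in auto)
  have steps: "(u, e, v) \<in> steps M \<longleftrightarrow> graph_step kind G u e v" for u e v
    using G(3) by (auto simp: steps_def graph_step_def tl_def hd_def)
  let ?\<sigma> = "input_state N M G s t c_hat"
  have "input ?\<sigma>"
    unfolding input_def by (simp add: input_state_def fun_eq_iff tl_def hd_def c_def)
  then obtain T \<rho> where \<rho>: "exec (fill_table kind) ?\<sigma> T \<rho>" "T \<le> 100 + Suc N * (Suc M * 500)" "rows (N - 1) {} \<rho>"
    using rows_fill_table N unfolding triple_def by (auto simp: input_state_def)
  define ed where "ed = narr \<rho> ''edge''"
  define pr where "pr = narr \<rho> ''prev''"
  define ds where "ds = rarr \<rho> ''dist''"
  define R where "R = narr \<rho> ''reach''"
  define D where "D = rarr \<rho> ''D''"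
  interpret program_table N t ed pr R D .
  have col: "R j = ed (j * N + t)" "D j = ds (j * N + t)" "rarr \<rho> ''X'' j = real j" if "j < N" for j
    using \<rho>(3) that N by (auto simp: rows_def columns_def R_def D_def ed_def ds_def)
  have tab: "table N s (steps M) c {} ed pr ds (N - 1)"
    using \<rho>(3) by (simp add: rows_def ed_def pr_def ds_def)
  have "frame \<rho>"
    using \<rho>(3) col(3) unfolding frame_def by (simp add: rows_def input_def ed_def pr_def R_def D_def)
  then obtain U \<tau> where \<tau>: "exec write_solution \<rho> U \<tau>" "U \<le> 100 + Suc N * (Suc N * 500)"
      "output_list \<tau> = map (\<lambda>j. walk j t) (chosen N)"
    using written_write_solution unfolding triple_def by blast
  define S where "S = (\<lambda>j. walk j t) ` envelope candidates D"
  have "envelope candidates D \<subseteq> {..<N}"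
    by (auto simp: envelope_def first_min_def candidates_def)
  then have "set (chosen N) = envelope candidates D"
    by (auto simp: chosen_def)
  moreover have "inj_on (\<lambda>j. walk j t) A" for A
    by (rule inj_onI) (metis length_backtrack)
  ultimately have "outputs_set \<tau> S"
    by (simp add: outputs_set_def \<tau>(3) S_def distinct_map chosen_def)
  have level: "level N (steps M) c ed pr ds i" if "Suc i < N" for i
    using tab that by (simp add: table_def)
  \<comment> \<open>The recorded columns match the table only for rows below \<open>N\<close>, where
    all candidates lie.\<close>
  have S: "S = (\<lambda>k. walk k t) ` envelope {k. k < N \<and> 0 < ed (k * N + t)} (\<lambda>k. ds (k * N + t))"
  proof -
    have "candidates = {k. k < N \<and> 0 < ed (k * N + t)}"
      using col by (auto simp: candidates_def)
    moreover have "envelope candidates D = envelope candidates (\<lambda>k. ds (k * N + t))"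
      using col by (auto simp: envelope_def first_min_def candidates_def)
    ultimately show ?thesis
      by (simp add: S_def)
  qed
  have sound: "graph_step kind G (pr (Suc i * N + v)) (ed (Suc i * N + v) - 1) v \<and>
      0 < ed (i * N + pr (Suc i * N + v)) \<and>
      ds (Suc i * N + v) = ds (i * N + pr (Suc i * N + v)) + c_hat (ed (Suc i * N + v) - 1)"
    if "Suc i < N" "v < N" "0 < ed (Suc i * N + v)" for i v
  proof -
    have *: "(pr (Suc i * N + v), ed (Suc i * N + v) - 1, v) \<in> steps M"
      "0 < ed (i * N + pr (Suc i * N + v))"
      "ds (Suc i * N + v) = ds (i * N + pr (Suc i * N + v)) + c (ed (Suc i * N + v) - 1)"
      using level[OF that(1)] that(2,3) unfolding level_def by blast+
    then have "ed (Suc i * N + v) - 1 < M"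
      using G(3) unfolding steps graph_step_def by blast
    then show ?thesis
      using * unfolding steps by (simp add: c_def)
  qed
  have complete: "0 < ed (Suc i * N + v) \<and> ds (Suc i * N + v) \<le> ds (i * N + u) + c_hat e"
    if "Suc i < N" "graph_step kind G u e v" "0 < ed (i * N + u)" for i u e v
  proof -
    have "e < M"
      using that(2) G(3) by (simp add: graph_step_def)
    then show ?thesis
      using level[OF that(1)] that(2,3) unfolding level_def steps[symmetric] by (auto simp: c_def)
  qed
  have init: "0 < ed (0 * N + v) \<longleftrightarrow> v = s" if "v < N" for v
    using tab that by (simp add: table_def)
  have "ds (0 * N + s) = 0"
    using tab by (simp add: table_def)
  note sol = table_solution[OF inst, where reach = "\<lambda>i v. 0 < ed (i * N + v)" and
      dist = "\<lambda>i v. ds (i * N + v)" and prv = "\<lambda>i v. pr (i * N + v)" and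
      edge = "\<lambda>i v. ed (i * N + v) - 1", OF init this sound complete S]
  show "\<exists>T \<tau> S. exec (Seq (fill_table kind) write_solution) ?\<sigma> T \<tau> \<and>
      real T \<le> 10000 * (real N * real M + (real N)\<^sup>2 * ln (real N)) \<and>
      outputs_set \<tau> S \<and>
      variable_sized_solution (st_paths kind G s t) c_hat (unit_box (arcs G)) S \<and> card S \<le> N"
  proof (intro exI[of _ "T + U"] exI[of _ \<tau>] exI[of _ S] conjI)
    show "exec (Seq (fill_table kind) write_solution) ?\<sigma> (T + U) \<tau>"
      using \<rho>(1) \<tau>(1) by (rule exec.Seq)
    show "real (T + U) \<le> 10000 * (real N * real M + (real N)\<^sup>2 * ln (real N))"
      using \<rho>(2) \<tau>(2) by (intro time_bound[OF N] add_mono)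
    show "outputs_set \<tau> S" by fact
    show "variable_sized_solution (st_paths kind G s t) c_hat (unit_box (arcs G)) S" "card S \<le> N"
      using sol by blast+
  qed
qed

end
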